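(* Let $H$ be a fixed finite simple graph with $v$ vertices and $\ell>1$ edges, such that every vertex of $H$ lies on at least one edge. Let $0<p<1$ and let $(E_n)$ be a sequence of integers, $0\le E_n\le N_n=\binom n2$, with $E_n=p\binom n2+O(1)$ as $n\to\infty$. For a random graph distributed according to $\mu_n(p)$ (uniform on the simple graphs on $n$ labeled vertices having exactly $E_n$ edges), the expectation and variance of the number $T_H$ of copies of $H$ satisfy, for $n\ge v$ (with all $O$-terms as $n\to\infty$), $$\langle T_H\rangle_{n,p}=c_n\,P(E_n,N_n,\ell)=c_n p^\ell+O(n^{v-2})=\frac{1}{|S_H|}\Big[n^v p^\ell-\frac{v(v-1)}{2}n^{v-1}p^\ell\Big]+O(n^{v-2}),$$ $$\mathrm{Var}(T_H)_{n,p}=C_2\,p^{2\ell-2}(1-p)^2+C_3\,p^{2\ell-3}(1-3p^2+2p^3)+O(n^{2v-4})=O(n^{2v-3}).$$ Moreover, if $H$ does not contain any triangles, then the term $C_3\,p^{2\ell-3}(1-3p^2+2p^3)$ is itself $O(n^{2v-4})$ (and so can be omitted from the formula for the variance).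
   Context: $G_n$ is the set of simple graphs on $n$ labeled vertices. For $g\in G_n$, $T_H(g)$ is the number of copies of $H$ in $g$, i.e. the number of (not necessarily induced) subgraphs of $g$ isomorphic to $H$. $\mu_n(p)$ is the uniform distribution on those $g\in G_n$ whose total number of edges is exactly $E_n$; $\langle\cdot\rangle_{n,p}$ and $\mathrm{Var}(\cdot)_{n,p}$ are expectation and variance with respect to $\mu_n(p)$. $N_n=\binom n2$. For a positive integer $k$, $$P(E_n,N_n,k)=\frac{E_n(E_n-1)\cdots(E_n+1-k)}{N_n(N_n-1)\cdots(N_n+1-k)}.$$ $S_H$ is the group of symmetries (automorphism group) of $H$. $c_n=n(n-1)\cdots(n+1-v)/|S_H|$ is the number of copies of $H$ in the complete graph on the $n$ vertices. For $0\le k\le\ell$, $C_k=C_k(n)$ is the number of ordered pairs of copies of $H$ in the complete graph on the $n$ vertices (the two copies being distinguishable as first and second, and allowed to coincide) that share exactly $k$ edges; $C_k=0$ for $k>\ell$. The constants implied in the $O$-terms may depend on $H$, $p$ and the sequence $(E_n)$, but not on $n$. *)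

theory Defs
  imports "HOL-Probability.Probability" "HOL-Library.Ramsey"
    "HOL-Library.Landau_Symbols" "HOL-Combinatorics.Permutations"
begin

type_synonym 'a graph = "'a set \<times> 'a set set"

abbreviation verts :: "'a graph \<Rightarrow> 'a set" where
  "verts \<equiv> fst"

abbreviation edges :: "'a graph \<Rightarrow> 'a set set" where
  "edges \<equiv> snd"

definition simple_graph :: "'a graph \<Rightarrow> bool" where
  "simple_graph G \<longleftrightarrow> finite (verts G) \<and> edges G \<subseteq> [verts G]\<^bsup>2\<^esup>"

definition subgraph :: "'a graph \<Rightarrow> 'a graph \<Rightarrow> bool" where
  "subgraph S G \<longleftrightarrow> simple_graph S \<and> verts S \<subseteq> verts G \<and> edges S \<subseteq> edges G"

definition graph_iso_map :: "('a \<Rightarrow> 'b) \<Rightarrow> 'a graph \<Rightarrow> 'b graph \<Rightarrow> bool" where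
  "graph_iso_map f G H \<longleftrightarrow>
     bij_betw f (verts G) (verts H) \<and> (\<lambda>e. f ` e) ` edges G = edges H"

definition isomorphic :: "'a graph \<Rightarrow> 'b graph \<Rightarrow> bool" where
  "isomorphic G H \<longleftrightarrow> (\<exists>f. graph_iso_map f G H)"

(* Since functions are total, an automorphism is represented by its extension that is
   the identity off the vertex set; this is what permutes enforces. *)
definition automorphisms :: "'a graph \<Rightarrow> ('a \<Rightarrow> 'a) set" where
  "automorphisms H = {f. f permutes verts H \<and> graph_iso_map f H H}"

definition has_triangle :: "'a graph \<Rightarrow> bool" where
  "has_triangle G \<longleftrightarrow>
     (\<exists>x y z. distinct [x, y, z] \<and> {x, y} \<in> edges G \<and> {y, z} \<in> edges G \<and> {x, z} \<in> edges G)"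

definition copies :: "'a graph \<Rightarrow> 'b graph \<Rightarrow> 'b graph set" where
  "copies H g = {S. subgraph S g \<and> isomorphic H S}"

definition num_copies :: "'a graph \<Rightarrow> 'b graph \<Rightarrow> nat" where
  "num_copies H g = card (copies H g)"

(* The n labels are 0, ..., n - 1. *)
definition labeled_graphs :: "nat \<Rightarrow> nat graph set" where
  "labeled_graphs n = {g. verts g = {..<n} \<and> simple_graph g}"

definition complete_graph :: "nat \<Rightarrow> nat graph" where
  "complete_graph n = ({..<n}, [{..<n}]\<^bsup>2\<^esup>)"

(* A genuine uniform distribution only for m <= n choose 2; otherwise the set is empty
   and pmf_of_set is unspecified. *)
definition graph_dist :: "nat \<Rightarrow> nat \<Rightarrow> nat graph pmf" where
  "graph_dist n m = pmf_of_set {g \<in> labeled_graphs n. card (edges g) = m}"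

definition falling_factorial :: "real \<Rightarrow> nat \<Rightarrow> real" where
  "falling_factorial x k = (\<Prod>i<k. x - real i)"

definition edge_prob :: "nat \<Rightarrow> nat \<Rightarrow> nat \<Rightarrow> real" where
  "edge_prob E N k = falling_factorial (real E) k / falling_factorial (real N) k"

definition c_coeff :: "'a graph \<Rightarrow> nat \<Rightarrow> real" where
  "c_coeff H n = falling_factorial (real n) (card (verts H)) / real (card (automorphisms H))"

definition C_coeff :: "'a graph \<Rightarrow> nat \<Rightarrow> nat \<Rightarrow> nat" where
  "C_coeff H k n =
     card {(A, B). A \<in> copies H (complete_graph n) \<and> B \<in> copies H (complete_graph n) \<and>
                   card (edges A \<inter> edges B) = k}"

end

theory Submission
  imports Defs "HOL-Real_Asymp.Real_Asymp"
begin

text \<open>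
  The variance is the sum over \<open>k\<close> of \<open>C\<^sub>k (P(2l - k) - P(l)\<^sup>2)\<close>. With \<open>q = E\<^sub>n / N\<^sub>n\<close> and
  \<open>a = q\<^bsup>2l-1\<^esup> (1 - q)\<close>, the \<open>k = 0\<close> factor is \<open>- l\<^sup>2 a / N\<^sub>n + O(N\<^sub>n\<^sup>-\<^sup>2)\<close>. It is not
  negligible, since there are about \<open>n\<^bsup>2v\<^esup>\<close> disjoint pairs. But \<open>\<Sum> C\<^sub>k = c\<^sub>n\<^sup>2\<close>, and because
  the complete graph is edge-transitive \<open>\<Sum> k C\<^sub>k = l\<^sup>2 c\<^sub>n\<^sup>2 / N\<^sub>n\<close> exactly, so the \<open>k = 0\<close>
  contribution can be redistributed as \<open>- k a\<close> over the other \<open>k\<close>. This cancels the leading part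
  of the \<open>k = 1\<close> term and produces the stated coefficients for \<open>k = 2, 3\<close>. Finally, two
  copies sharing \<open>2\<close> edges share \<open>3\<close> vertices and two copies sharing \<open>4\<close> edges share \<open>4\<close>
  vertices; sharing exactly \<open>3\<close> edges on only \<open>3\<close> vertices means sharing a triangle.
\<close>

subsection \<open>Copies in the complete graph\<close>

definition map_graph :: "('a \<Rightarrow> 'b) \<Rightarrow> 'a graph \<Rightarrow> 'b graph" where
  "map_graph f G = (f ` verts G, (`) f ` edges G)"

lemma verts_map_graph [simp]: "verts (map_graph f G) = f ` verts G"
  and edges_map_graph [simp]: "edges (map_graph f G) = (`) f ` edges G"
  by (simp_all add: map_graph_def)

text \<open>Isomorphism becomes injectivity plus an equation between graphs, so maps between copies
  can be composed by rewriting.\<close>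

lemma graph_iso_map_iff:
  "graph_iso_map f G H \<longleftrightarrow> inj_on f (verts G) \<and> map_graph f G = H"
  by (cases H) (auto simp: graph_iso_map_def bij_betw_def map_graph_def)

lemma isomorphicE:
  assumes "isomorphic G H"
  obtains f where "inj_on f (verts G)" "map_graph f G = H"
  using assms by (metis isomorphic_def graph_iso_map_iff)

lemma map_graph_map_graph: "map_graph g (map_graph f G) = map_graph (g \<circ> f) G"
  by (simp add: map_graph_def image_comp image_image o_def)

lemma map_graph_id: "map_graph id G = G"
  by (simp add: map_graph_def)

lemma edge_subset_verts: "simple_graph G \<Longrightarrow> e \<in> edges G \<Longrightarrow> e \<subseteq> verts G"
  by (auto simp: simple_graph_def nsets_def)

lemma finite_edges: "simple_graph G \<Longrightarrow> finite (edges G)"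
  by (meson finite_imp_finite_nsets finite_subset simple_graph_def)

text \<open>Edges of a simple graph lie inside its vertex set, so values elsewhere cannot matter.
  This permits passing to extensional maps, which can be counted.\<close>

lemma map_graph_cong:
  assumes "simple_graph G" and eq: "\<And>x. x \<in> verts G \<Longrightarrow> f x = g x"
  shows "map_graph f G = map_graph g G"
proof -
  have "f ` e = g ` e" if "e \<in> edges G" for e
    using edge_subset_verts[OF assms(1) that] eq by (intro image_cong) auto
  then show ?thesis
    unfolding map_graph_def using eq by (auto simp: image_iff)
qed

lemma inj_on_image_edges:
  assumes "simple_graph G" "inj_on f (verts G)"
  shows "inj_on ((`) f) (edges G)"
  using edge_subset_verts[OF assms(1)]
  by (intro inj_onI) (meson assms(2) inj_on_image_eq_iff)

lemma simple_map_graph: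
  assumes "simple_graph G" "inj_on f (verts G)"
  shows "simple_graph (map_graph f G)"
proof -
  have "f ` e \<in> [f ` verts G]\<^bsup>2\<^esup>" if "e \<in> edges G" for e
  proof -
    have "e \<in> [verts G]\<^bsup>2\<^esup>"
      using assms that by (auto simp: simple_graph_def)
    then show ?thesis
      using assms(2) unfolding nsets_def by (auto simp: card_image inj_on_subset)
  qed
  then show ?thesis
    using assms(1) by (auto simp: simple_graph_def)
qed

lemma isomorphic_sizes:
  assumes "simple_graph H" "isomorphic H S"
  shows "card (verts S) = card (verts H)" "card (edges S) = card (edges H)"
proof -
  obtain f where "inj_on f (verts H)" "map_graph f H = S"
    using assms(2) by (rule isomorphicE)
  then show "card (verts S) = card (verts H)" "card (edges S) = card (edges H)"
    using inj_on_image_edges[OF assms(1), of f] by (auto simp: card_image)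
qed

text \<open>Every 2-subset of the labels is an edge of the complete graph, so the edge condition in
  \<open>subgraph\<close> holds automatically.\<close>

lemma in_copies_complete:
  "S \<in> copies H (complete_graph n) \<longleftrightarrow> simple_graph S \<and> verts S \<subseteq> {..<n} \<and> isomorphic H S"
proof -
  have "edges S \<subseteq> [{..<n}]\<^bsup>2\<^esup>" if "simple_graph S" "verts S \<subseteq> {..<n}"
    using that nsets_mono[of "verts S" "{..<n}" 2] by (auto simp: simple_graph_def)
  then show ?thesis
    by (auto simp: copies_def subgraph_def complete_graph_def)
qed

lemma edges_copy_subset:
  "S \<in> copies H (complete_graph n) \<Longrightarrow> edges S \<subseteq> [{..<n}]\<^bsup>2\<^esup>"
  by (auto simp: copies_def subgraph_def complete_graph_def)

lemma finite_copies_complete: "finite (copies H (complete_graph n))"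
proof (rule finite_subset)
  show "copies H (complete_graph n) \<subseteq> Pow {..<n} \<times> Pow ([{..<n}]\<^bsup>2\<^esup>)"
    by (auto simp: copies_def subgraph_def complete_graph_def)
qed (auto intro: finite_imp_finite_nsets)

text \<open>Since \<open>g\<close> carries all \<open>n\<close> labels, only the edge condition
  separates its copies from those in the complete graph. Copies can thus be indexed by a set that
  does not depend on \<open>g\<close>.\<close>

lemma copies_labeled:
  assumes "g \<in> labeled_graphs n"
  shows "copies H g = {S \<in> copies H (complete_graph n). edges S \<subseteq> edges g}"
  using assms unfolding labeled_graphs_def copies_def subgraph_def complete_graph_def simple_graph_def
  by auto

section \<open>Counting copies as embeddings modulo automorphisms\<close>

lemma finite_automorphisms: "finite (verts H) \<Longrightarrow> finite (automorphisms H)"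
  by (rule finite_subset[OF _ finite_permutations[of "verts H"]]) (auto simp: automorphisms_def)

lemma card_automorphisms_pos:
  assumes "finite (verts H)"
  shows "card (automorphisms H) > 0"
proof -
  have "id \<in> automorphisms H"
    by (auto simp: automorphisms_def permutes_id graph_iso_map_def)
  then show ?thesis
    using finite_automorphisms[OF assms] by (auto simp: card_gt_0_iff)
qed

text \<open>Precomposing \<open>f0\<close> with the automorphisms of \<open>H\<close> produces each
  embedding with the same image graph exactly once.\<close>

lemma card_embeddings_with_image:
  fixes H :: "'a graph" and T :: "'b set"
  assumes H: "simple_graph H" and f0: "f0 \<in> verts H \<rightarrow>\<^sub>E T" "inj_on f0 (verts H)"
  shows "card {f \<in> verts H \<rightarrow>\<^sub>E T. inj_on f (verts H) \<and> map_graph f H = map_graph f0 H}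
       = card (automorphisms H)"
proof -
  let ?V = "verts H" and ?S = "map_graph f0 H"
  let ?F = "{f \<in> ?V \<rightarrow>\<^sub>E T. inj_on f ?V \<and> map_graph f H = ?S}"
  have "bij_betw (\<lambda>s. restrict (f0 \<circ> s) ?V) (automorphisms H) ?F"
  proof (rule bij_betwI')
    fix s t assume st: "s \<in> automorphisms H" "t \<in> automorphisms H"
    then have p: "s permutes ?V" "t permutes ?V"
      by (auto simp: automorphisms_def)
    show "restrict (f0 \<circ> s) ?V = restrict (f0 \<circ> t) ?V \<longleftrightarrow> s = t"
    proof
      assume eq: "restrict (f0 \<circ> s) ?V = restrict (f0 \<circ> t) ?V"
      show "s = t"
      proof
        fix x
        show "s x = t x"
        proof (cases "x \<in> ?V")
          case True
          then have "f0 (s x) = f0 (t x)"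
            using fun_cong[OF eq, of x] by simp
          then show ?thesis
            using inj_onD[OF f0(2)] True p by (simp add: permutes_in_image)
        next
          case False
          then show ?thesis
            using p by (auto simp: permutes_def)
        qed
      qed
    qed simp
  next
    fix s assume s: "s \<in> automorphisms H"
    then have p: "s permutes ?V" and i: "map_graph s H = H"
      by (auto simp: automorphisms_def graph_iso_map_iff)
    have "map_graph (restrict (f0 \<circ> s) ?V) H = map_graph (f0 \<circ> s) H"
      by (rule map_graph_cong[OF H]) auto
    also have "\<dots> = ?S"
      using i map_graph_map_graph[of f0 s H] by simp
    finally have "map_graph (restrict (f0 \<circ> s) ?V) H = ?S" .
    moreover have "inj_on (f0 \<circ> s) ?V"
      using p f0(2) by (intro comp_inj_on) (auto simp: permutes_inj_on permutes_image)
    moreover have "restrict (f0 \<circ> s) ?V \<in> ?V \<rightarrow>\<^sub>E T"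
      using f0(1) p by (auto simp: permutes_in_image)
    ultimately show "restrict (f0 \<circ> s) ?V \<in> ?F"
      by (auto simp: inj_on_def)
  next
    fix f assume f: "f \<in> ?F"
    then have inj: "inj_on f ?V" and ext: "f \<in> extensional ?V" and mg: "map_graph f H = ?S"
      by (auto simp: PiE_def)
    have im: "f ` ?V = f0 ` ?V"
      using mg by (simp add: map_graph_def)
    \<comment> \<open>The automorphism that yields \<open>f\<close> is the inverse of
      \<open>f0\<close> after \<open>f\<close>, extended by the identity as \<open>permutes\<close>
      demands.\<close>
    define g where "g = inv_into ?V f0"
    define s where "s = (\<lambda>x. if x \<in> ?V then g (f x) else x)"
    have f0s: "f0 (s x) = f x" if "x \<in> ?V" for x
      using that im f_inv_into_f[of "f x" f0 ?V] by (auto simp: s_def g_def)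
    have bg: "bij_betw g (f0 ` ?V) ?V"
      unfolding g_def using f0(2) by (simp add: bij_betw_inv_into inj_on_imp_bij_betw)
    have "bij_betw f ?V (f0 ` ?V)"
      using inj im by (auto simp: bij_betw_def)
    then have "bij_betw (g \<circ> f) ?V ?V"
      using bg by (rule bij_betw_trans)
    then have bs: "bij_betw s ?V ?V"
      using bij_betw_cong[of ?V s "g \<circ> f"] by (simp add: s_def)
    then have p: "s permutes ?V"
      by (rule bij_imp_permutes) (auto simp: s_def)
    have "map_graph s H = map_graph (g \<circ> f) H"
      by (rule map_graph_cong[OF H]) (auto simp: s_def)
    also have "\<dots> = map_graph (g \<circ> f0) H"
      using mg by (simp flip: map_graph_map_graph)
    also have "\<dots> = map_graph id H"
      by (rule map_graph_cong[OF H]) (use f0(2) in \<open>auto simp: g_def\<close>)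
    also have "\<dots> = H"
      by (rule map_graph_id)
    finally have "s \<in> automorphisms H"
      using p bs by (auto simp: automorphisms_def graph_iso_map_iff bij_betw_def)
    moreover have "f = restrict (f0 \<circ> s) ?V"
      using ext f0s by (auto simp: extensional_def fun_eq_iff)
    ultimately show "\<exists>s\<in>automorphisms H. f = restrict (f0 \<circ> s) ?V"
      by blast
  qed
  then show ?thesis
    by (simp add: bij_betw_same_card)
qed

lemma card_embeddings:
  assumes "finite V"
  shows "real (card {f \<in> V \<rightarrow>\<^sub>E {..<n::nat}. inj_on f V}) = falling_factorial (real n) (card V)"
proof -
  have "card {f \<in> V \<rightarrow>\<^sub>E {..<n}. inj_on f V} = (\<Prod>i<card V. n - i)"
    using card_inj_on_subset_funcset[OF assms finite_lessThan order_refl]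
    by (simp add: atLeast0LessThan)
  also have "real \<dots> = falling_factorial (real n) (card V)"
  \<comment> \<open>Subtraction truncates on the left but not on the right. When
    \<open>card V > n\<close> both products still agree, because the factor at \<open>i = n\<close>
    is 0.\<close>
  proof (cases "card V \<le> n")
    case True
    then show ?thesis
      by (auto simp: falling_factorial_def of_nat_diff intro!: prod.cong)
  next
    case False
    then have "n \<in> {..<card V}"
      by simp
    then have "(\<Prod>i<card V. n - i) = 0" "falling_factorial (real n) (card V) = 0"
      unfolding falling_factorial_def by (auto intro!: prod_zero bexI[of _ n])
    then show ?thesis
      by simp
  qed
  finally show ?thesis .
qed

text \<open>Group the embeddings of \<open>H\<close> by their image: every fibre has as many
  elements as there are automorphisms. For \<open>n < card (verts H)\<close> both sides are
  0.\<close>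

lemma card_copies_complete:
  assumes H: "simple_graph H"
  shows "real (card (copies H (complete_graph n))) = c_coeff H n"
proof -
  let ?V = "verts H" and ?C = "copies H (complete_graph n)"
  let ?I = "{f \<in> ?V \<rightarrow>\<^sub>E {..<n}. inj_on f ?V}"
  have fV: "finite ?V"
    using H by (simp add: simple_graph_def)
  have fI: "finite ?I"
    using finite_PiE[OF fV, of "\<lambda>_. {..<n}"] by auto
  have sub: "(\<lambda>f. map_graph f H) ` ?I \<subseteq> ?C"
  proof (rule image_subsetI)
    fix f assume "f \<in> ?I"
    then have f: "f \<in> ?V \<rightarrow>\<^sub>E {..<n}" "inj_on f ?V"
      by auto
    then have "isomorphic H (map_graph f H)"
      by (auto simp: isomorphic_def graph_iso_map_iff)
    then show "map_graph f H \<in> ?C"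
      using f simple_map_graph[OF H f(2)] by (auto simp: in_copies_complete)
  qed
  have fib: "card {f \<in> ?I. map_graph f H = S} = card (automorphisms H)" if S: "S \<in> ?C" for S
  proof -
    obtain f where f: "inj_on f ?V" "map_graph f H = S"
      using S by (metis in_copies_complete isomorphicE)
    \<comment> \<open>The isomorphism is arbitrary off the vertices; restricting it lands in the
      extensional function space and keeps the image.\<close>
    define f0 where "f0 = restrict f ?V"
    have m: "map_graph f0 H = S"
      unfolding f(2)[symmetric] by (rule map_graph_cong[OF H]) (auto simp: f0_def)
    moreover have "f0 \<in> ?V \<rightarrow>\<^sub>E {..<n}"
      using S f(2) by (auto simp: in_copies_complete f0_def subset_iff)
    moreover have "inj_on f0 ?V"
      using f(1) by (auto simp: f0_def inj_on_def)
    ultimately show ?thesis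
      using card_embeddings_with_image[OF H, of f0 "{..<n}"] by (auto simp: conj_assoc)
  qed
  have "card ?I = (\<Sum>S\<in>?C. card {f \<in> ?I. map_graph f H = S})"
    using sum.group[OF fI finite_copies_complete sub, of "\<lambda>_. 1::nat"] by simp
  also have "\<dots> = card ?C * card (automorphisms H)"
    using fib by simp
  finally show ?thesis
    using card_embeddings[OF fV, of n] card_automorphisms_pos[OF fV]
    by (simp add: c_coeff_def field_simps)
qed

section \<open>Edge-transitivity of the complete graph and the mean overlap\<close>

text \<open>A bijection from \<open>e\<close> to \<open>e'\<close> and one between the complements,
  which have equal size, are glued together.\<close>

lemma ex_permutation_edge:
  assumes "finite X" "e \<in> [X]\<^bsup>k\<^esup>" "e' \<in> [X]\<^bsup>k\<^esup>"
  obtains f where "f permutes X" "f ` e = e'"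
proof -
  have fin: "finite e" "finite e'" "e \<subseteq> X" "e' \<subseteq> X" "card e = card e'"
    using assms by (auto simp: nsets_def)
  obtain f where f: "bij_betw f e e'"
    using finite_same_card_bij[OF fin(1,2,5)] by auto
  have "card (X - e) = card (X - e')"
    using fin by (simp add: card_Diff_subset)
  then obtain g where g: "bij_betw g (X - e) (X - e')"
    using finite_same_card_bij[of "X - e" "X - e'"] assms(1) by auto
  define h where "h = (\<lambda>x. if x \<in> e then f x else if x \<in> X then g x else x)"
  have 1: "bij_betw h e e'"
    using f bij_betw_cong[of e h f] by (simp add: h_def)
  have 2: "bij_betw h (X - e) (X - e')"
    using g bij_betw_cong[of "X - e" h g] by (simp add: h_def)
  have "bij_betw h (e \<union> (X - e)) (e' \<union> (X - e'))"
    by (rule bij_betw_combine[OF 1 2]) auto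
  then have "bij_betw h X X"
    using fin by (simp add: Un_absorb1)
  then have "h permutes X"
    by (rule bij_imp_permutes) (use fin in \<open>auto simp: h_def\<close>)
  moreover have "h ` e = e'"
    using 1 by (simp add: bij_betw_def)
  ultimately show ?thesis
    using that by blast
qed

text \<open>Relabelling by a permutation that takes \<open>e\<close> to \<open>e'\<close> sends
  copies through \<open>e\<close> injectively to copies through \<open>e'\<close>. Exchanging the
  edges gives equality.\<close>

lemma card_copies_through_edge_le:
  assumes "e \<in> [{..<n}]\<^bsup>2\<^esup>" "e' \<in> [{..<n}]\<^bsup>2\<^esup>"
  shows "card {A \<in> copies H (complete_graph n). e \<in> edges A}
       \<le> card {A \<in> copies H (complete_graph n). e' \<in> edges A}"
proof -
  obtain f where f: "f permutes {..<n}" "f ` e = e'"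
    using ex_permutation_edge[OF _ assms] by auto
  have inj: "inj f"
    using f(1) by (rule permutes_inj)
  show ?thesis
  proof (rule card_inj_on_le[where f = "map_graph f"])
    show "inj_on (map_graph f) {A \<in> copies H (complete_graph n). e \<in> edges A}"
      by (rule inj_on_inverseI[where g = "map_graph (inv f)"])
         (simp add: map_graph_map_graph inj map_graph_id)
    show "map_graph f ` {A \<in> copies H (complete_graph n). e \<in> edges A}
        \<subseteq> {A \<in> copies H (complete_graph n). e' \<in> edges A}"
    proof (rule image_subsetI)
      fix A assume "A \<in> {A \<in> copies H (complete_graph n). e \<in> edges A}"
      then have A: "A \<in> copies H (complete_graph n)" "e \<in> edges A"
        by auto
      then obtain h where h: "inj_on h (verts H)" "map_graph h H = A"
        by (metis in_copies_complete isomorphicE)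
      have "isomorphic H (map_graph f A)"
        unfolding isomorphic_def graph_iso_map_iff
        using h inj by (intro exI[of _ "f \<circ> h"])
          (auto simp flip: map_graph_map_graph intro!: comp_inj_on elim: inj_on_subset)
      moreover have "simple_graph (map_graph f A)"
        using A inj by (intro simple_map_graph) (auto simp: in_copies_complete elim: inj_on_subset)
      moreover have "f ` verts A \<subseteq> {..<n}"
        using A(1) f(1) permutes_image[OF f(1)] by (auto simp: in_copies_complete)
      moreover have "e' \<in> edges (map_graph f A)"
        using A(2) f(2) by auto
      ultimately show "map_graph f A \<in> {A \<in> copies H (complete_graph n). e' \<in> edges A}"
        by (simp add: in_copies_complete)
    qed
  qed (use finite_copies_complete[of H n] in simp)
qed

text \<open>Double counting of incidences. \<open>Y\<close> will be \<open>UNIV\<close> to count all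
  edges of all copies, and the edge set of a fixed copy to count overlaps with it.\<close>

lemma sum_card_inter:
  assumes "finite I" "\<And>i. i \<in> I \<Longrightarrow> A i \<subseteq> X" "finite X"
  shows "(\<Sum>i\<in>I. card (A i \<inter> Y)) = (\<Sum>x\<in>X \<inter> Y. card {i \<in> I. x \<in> A i})"
proof -
  have "(\<Sum>i\<in>I. card (A i \<inter> Y)) = (\<Sum>i\<in>I. \<Sum>x\<in>X \<inter> Y. if x \<in> A i then 1 else 0)"
  proof (rule sum.cong[OF refl])
    fix i assume "i \<in> I"
    then have "A i \<inter> Y = (X \<inter> Y) \<inter> {x. x \<in> A i}"
      using assms(2) by auto
    then show "card (A i \<inter> Y) = (\<Sum>x\<in>X \<inter> Y. if x \<in> A i then 1 else 0)"
      using assms(3) by (simp add: sum.If_cases Int_assoc)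
  qed
  also have "\<dots> = (\<Sum>x\<in>X \<inter> Y. \<Sum>i\<in>I. if x \<in> A i then 1 else 0)"
    by (rule sum.swap)
  also have "\<dots> = (\<Sum>x\<in>X \<inter> Y. card {i \<in> I. x \<in> A i})"
    using assms(1) by (intro sum.cong refl) (simp add: sum.If_cases Int_def)
  finally show ?thesis .
qed

text \<open>The complete graph is edge-transitive, so every edge lies in the same number of copies
  and the average overlap of two copies is known exactly.\<close>

lemma sum_card_common_edges:
  assumes H: "simple_graph H"
  defines "C \<equiv> \<lambda>n. copies H (complete_graph n)"
  shows "real (n choose 2) * real (\<Sum>A\<in>C n. \<Sum>B\<in>C n. card (edges A \<inter> edges B))
       = (real (card (edges H)) * c_coeff H n)\<^sup>2"
proof -
  let ?X = "[{..<n}]\<^bsup>2\<^esup>" and ?l = "card (edges H)" and ?C = "C n"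
  define d where "d = (\<lambda>e. card {A \<in> ?C. e \<in> edges A})"
  have fX: "finite ?X"
    by (simp add: finite_imp_finite_nsets)
  have fC: "finite ?C"
    by (simp add: C_def finite_copies_complete)
  have sub: "edges A \<subseteq> ?X" and ce: "card (edges A) = ?l" if "A \<in> ?C" for A
    using that edges_copy_subset[of A H n] isomorphic_sizes(2)[OF H, of A]
    by (simp_all add: C_def in_copies_complete)
  have d_eq: "d e = d e'" if "e \<in> ?X" "e' \<in> ?X" for e e'
    using that unfolding d_def C_def by (intro order_antisym card_copies_through_edge_le)
  \<comment> \<open>The common number of copies through an edge. For \<open>n < 2\<close> there is
    no edge, the chosen value is arbitrary, and \<open>d e = D\<close> is vacuous.\<close>
  define D where "D = d (SOME e. e \<in> ?X)"
  have D: "d e = D" if "e \<in> ?X" for e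
    unfolding D_def using that someI[of "\<lambda>e. e \<in> ?X" e] by (intro d_eq)
  have "(\<Sum>A\<in>?C. card (edges A \<inter> UNIV)) = (\<Sum>e\<in>?X \<inter> UNIV. d e)"
    unfolding d_def by (rule sum_card_inter[OF fC sub fX])
  then have 1: "card ?C * ?l = (n choose 2) * D"
    using ce D by simp
  \<comment> \<open>The intersection is commuted so that the fixed copy \<open>A\<close> plays the
    role of \<open>Y\<close> in the double count.\<close>
  have "(\<Sum>A\<in>?C. \<Sum>B\<in>?C. card (edges A \<inter> edges B)) = (\<Sum>A\<in>?C. \<Sum>B\<in>?C. card (edges B \<inter> edges A))"
    by (simp add: Int_commute)
  also have "\<dots> = (\<Sum>A\<in>?C. \<Sum>e\<in>?X \<inter> edges A. d e)"
    unfolding d_def by (intro sum.cong refl sum_card_inter[OF fC sub fX])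
  also have "\<dots> = (\<Sum>A\<in>?C. ?l * D)"
  proof (rule sum.cong[OF refl])
    fix A assume "A \<in> ?C"
    then have "?X \<inter> edges A = edges A" and "card (edges A) = ?l"
      using sub[of A] ce[of A] by blast+
    moreover have "(\<Sum>e\<in>edges A. d e) = (\<Sum>e\<in>edges A. D)"
      using sub[OF \<open>A \<in> ?C\<close>] by (intro sum.cong refl D) (rule subsetD)
    ultimately show "(\<Sum>e\<in>?X \<inter> edges A. d e) = ?l * D"
      by simp
  qed
  \<comment> \<open>The overlaps total \<open>card ?C * ?l * D\<close>; the extra factor
    \<open>n choose 2\<close> turns \<open>D\<close> into a second \<open>card ?C * ?l\<close> by
    fact \<open>1\<close>.\<close>
  finally have "(n choose 2) * (\<Sum>A\<in>?C. \<Sum>B\<in>?C. card (edges A \<inter> edges B))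
      = card ?C * ?l * ((n choose 2) * D)"
    by (simp add: mult_ac)
  also have "\<dots> = (?l * card ?C)\<^sup>2"
    by (simp add: power2_eq_square flip: 1)
  finally have "real ((n choose 2) * (\<Sum>A\<in>?C. \<Sum>B\<in>?C. card (edges A \<inter> edges B)))
      = (real ?l * real (card ?C))\<^sup>2"
    by simp
  then show ?thesis
    using card_copies_complete[OF H, of n] by (simp add: C_def)
qed

subsection \<open>Overlapping copies\<close>

lemma card_common_edges_le:
  assumes "simple_graph A" "simple_graph B"
  shows "card (edges A \<inter> edges B) \<le> card (verts A \<inter> verts B) choose 2"
proof -
  have "edges A \<inter> edges B \<subseteq> [verts A \<inter> verts B]\<^bsup>2\<^esup>"
    using assms unfolding simple_graph_def nsets_def by blast
  moreover have "finite ([verts A \<inter> verts B]\<^bsup>2\<^esup>)"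
    using assms by (intro finite_imp_finite_nsets) (simp add: simple_graph_def)
  ultimately show ?thesis
    using card_mono[of "[verts A \<inter> verts B]\<^bsup>2\<^esup>" "edges A \<inter> edges B"] by simp
qed

lemma binomial_2_less_imp_less: "m choose 2 < n choose 2 \<Longrightarrow> m < (n::nat)"
  by (meson binomial_right_mono leD not_less)

text \<open>An injective vertex map lets each edge of the image be pulled back uniquely, so copies
  of a triangle-free graph are triangle-free.\<close>

lemma has_triangle_map_graph:
  assumes H: "simple_graph H" and inj: "inj_on f (verts H)" and tri: "has_triangle (map_graph f H)"
  shows "has_triangle H"
proof -
  obtain x y z where d: "distinct [x, y, z]"
    and e: "{x, y} \<in> edges (map_graph f H)" "{y, z} \<in> edges (map_graph f H)"
      "{x, z} \<in> edges (map_graph f H)"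
    using tri by (auto simp: has_triangle_def)
  have "{x, y} \<subseteq> f ` verts H" "{y, z} \<subseteq> f ` verts H"
    using e(1,2) edge_subset_verts[OF simple_map_graph[OF H inj]] by auto
  then obtain a b c where abc: "a \<in> verts H" "b \<in> verts H" "c \<in> verts H" "x = f a" "y = f b" "z = f c"
    by auto
  have edge: "{s, t} \<in> edges H"
    if st: "{f s, f t} \<in> edges (map_graph f H)" "s \<in> verts H" "t \<in> verts H" for s t
  proof -
    obtain u where u: "u \<in> edges H" "f ` u = f ` {s, t}"
      using st(1) by auto
    then have "u = {s, t}"
      using inj_on_image_eq_iff[OF inj edge_subset_verts[OF H u(1)], of "{s, t}"] st by auto
    then show ?thesis
      using u by simp
  qed
  have "{a, b} \<in> edges H" "{b, c} \<in> edges H" "{a, c} \<in> edges H"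
    using e abc by (auto intro!: edge)
  then show ?thesis
    unfolding has_triangle_def using d abc by (intro exI[of _ a] exI[of _ b] exI[of _ c]) auto
qed

text \<open>Three edges do not fit on two vertices, and on exactly three vertices they exhaust all
  pairs and form a triangle.\<close>

lemma three_common_edges_triangle_free:
  assumes A: "simple_graph A" and B: "simple_graph B" and tri: "\<not> has_triangle A"
    and 3: "card (edges A \<inter> edges B) = 3"
  shows "4 \<le> card (verts A \<inter> verts B)"
proof (rule ccontr)
  let ?S = "verts A \<inter> verts B"
  assume "\<not> 4 \<le> card ?S"
  moreover have "2 choose 2 < card ?S choose 2"
    using card_common_edges_le[OF A B] 3 by simp
  then have "2 < card ?S"
    by (rule binomial_2_less_imp_less)
  ultimately have c3: "card ?S = 3"
    by simp
  have fin: "finite ([?S]\<^bsup>2\<^esup>)"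
    using A by (intro finite_imp_finite_nsets) (simp add: simple_graph_def)
  have "edges A \<inter> edges B \<subseteq> [?S]\<^bsup>2\<^esup>"
    using A B unfolding simple_graph_def nsets_def by blast
  moreover have "card ([?S]\<^bsup>2\<^esup>) = card (edges A \<inter> edges B)"
    using c3 3 by (simp add: choose_two)
  ultimately have eq: "edges A \<inter> edges B = [?S]\<^bsup>2\<^esup>"
    using fin by (metis card_subset_eq)
  obtain x y z where xyz: "?S = {x, y, z}" "distinct [x, y, z]"
    using c3 by (auto simp: card_3_iff)
  have "{x, y} \<in> [?S]\<^bsup>2\<^esup>" "{y, z} \<in> [?S]\<^bsup>2\<^esup>" "{x, z} \<in> [?S]\<^bsup>2\<^esup>"
    unfolding xyz(1) using xyz(2) by auto
  then have "{x, y} \<in> edges A" "{y, z} \<in> edges A" "{x, z} \<in> edges A"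
    unfolding eq[symmetric] by blast+
  then have "has_triangle A"
    unfolding has_triangle_def using xyz(2) by blast
  with tri show False
    by contradiction
qed

text \<open>Two copies meeting in at least \<open>s\<close> vertices span at most \<open>2 v - s\<close> vertices, and on a
  fixed vertex set of that size there are only boundedly many pairs of graphs.\<close>

lemma C_coeff_bigo:
  assumes H: "simple_graph H"
    and shared: "\<And>n A B. \<lbrakk>A \<in> copies H (complete_graph n); B \<in> copies H (complete_graph n);
        card (edges A \<inter> edges B) = k\<rbrakk> \<Longrightarrow> s \<le> card (verts A \<inter> verts B)"
  shows "(\<lambda>n. real (C_coeff H k n)) \<in> O(\<lambda>n. real n ^ (2 * card (verts H) - s))"
proof -
  define m where "m = 2 * card (verts H) - s"
  \<comment> \<open>An \<open>m\<close>-set \<open>U\<close> has \<open>2 ^ m\<close> subsets as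
    vertex sets and \<open>2 ^ 2 ^ m\<close> sets of subsets as edge sets; the product is squared
    for ordered pairs.\<close>
  define K where "K = (2 ^ m * 2 ^ 2 ^ m * (2 ^ m * 2 ^ 2 ^ m) :: nat)"
  define G where "G = (\<lambda>U::nat set. Pow U \<times> Pow (Pow U))"
  have bound: "C_coeff H k n \<le> K * n ^ m" if n: "n \<ge> m" for n
  proof -
    let ?P = "{(A, B). A \<in> copies H (complete_graph n) \<and> B \<in> copies H (complete_graph n) \<and>
                   card (edges A \<inter> edges B) = k}"
    have fU: "finite U" "card U = m" if "U \<in> [{..<n}]\<^bsup>m\<^esup>" for U
      using that by (auto simp: nsets_def)
    have "?P \<subseteq> (\<Union>U\<in>[{..<n}]\<^bsup>m\<^esup>. G U \<times> G U)"
    proof safe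
      fix VA VB :: "nat set" and EA EB :: "nat set set"
      define A B where AB: "A = (VA, EA)" "B = (VB, EB)"
      assume "(VA, EA) \<in> copies H (complete_graph n)" "(VB, EB) \<in> copies H (complete_graph n)"
        and "k = card (edges (VA, EA) \<inter> edges (VB, EB))"
      then have c: "A \<in> copies H (complete_graph n)" "B \<in> copies H (complete_graph n)"
        and k: "card (edges A \<inter> edges B) = k"
        unfolding AB by auto
      then have g: "simple_graph A" "verts A \<subseteq> {..<n}" "isomorphic H A"
        "simple_graph B" "verts B \<subseteq> {..<n}" "isomorphic H B"
        by (metis in_copies_complete)+
      have "card (verts A \<union> verts B) + card (verts A \<inter> verts B) = 2 * card (verts H)"
        using card_Un_Int[of "verts A" "verts B"] g isomorphic_sizes(1)[OF H g(3)]
          isomorphic_sizes(1)[OF H g(6)]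
        by (simp add: simple_graph_def)
      then have "card (verts A \<union> verts B) \<le> m"
        using shared[OF c k] by (simp add: m_def)
      \<comment> \<open>The union may have fewer than \<open>m\<close> vertices; it is padded to
        exactly \<open>m\<close>, so that pairs are indexed by at most \<open>n ^ m\<close>
        sets.\<close>
      then obtain U where U: "verts A \<union> verts B \<subseteq> U" "U \<subseteq> {..<n}" "card U = m"
        using exists_subset_between[of "verts A \<union> verts B" m "{..<n}"] n g(2,5) by auto
      have G: "S \<in> G U" if "simple_graph S" "verts S \<subseteq> U" for S
        using that edge_subset_verts[OF that(1)] by (cases S) (force simp: G_def)
      have "A \<in> G U" "B \<in> G U"
        using U(1) g by (auto intro!: G)
      moreover have "U \<in> [{..<n}]\<^bsup>m\<^esup>"
        using U by (auto simp: nsets_def intro: finite_subset)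
      ultimately show "((VA, EA), VB, EB) \<in> (\<Union>U\<in>[{..<n}]\<^bsup>m\<^esup>. G U \<times> G U)"
        unfolding AB by blast
    qed
    then have "C_coeff H k n \<le> card (\<Union>U\<in>[{..<n}]\<^bsup>m\<^esup>. G U \<times> G U)"
      unfolding C_coeff_def using fU
      by (intro card_mono finite_UN_I finite_imp_finite_nsets) (auto simp: G_def)
    also have "\<dots> \<le> (\<Sum>U\<in>[{..<n}]\<^bsup>m\<^esup>. card (G U \<times> G U))"
      by (rule card_UN_le) (simp add: finite_imp_finite_nsets)
    also have "\<dots> = (\<Sum>U\<in>[{..<n}]\<^bsup>m\<^esup>. K)"
      using fU by (intro sum.cong refl) (simp add: G_def K_def card_cartesian_product card_Pow)
    also have "\<dots> \<le> K * n ^ m"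
      using binomial_le_pow[OF n] by simp
    finally show ?thesis .
  qed
  have "real (C_coeff H k n) \<le> real K * real n ^ m" if "n \<ge> m" for n
    using of_nat_mono[OF bound[OF that]] by simp
  then show ?thesis
    unfolding m_def[symmetric]
    by (intro bigoI[of _ "real K"] eventually_sequentiallyI[of m]) simp
qed

text \<open>More than \<open>(s - 1) choose 2\<close> common edges cannot live on
  \<open>s - 1\<close> common vertices.\<close>

lemma C_coeff_bigo_le:
  assumes "simple_graph H" "(s - 1) choose 2 < k"
  shows "(\<lambda>n. real (C_coeff H k n)) \<in> O(\<lambda>n. real n ^ (2 * card (verts H) - s))"
proof (rule C_coeff_bigo[OF assms(1)])
  fix n A B
  assume "A \<in> copies H (complete_graph n)" "B \<in> copies H (complete_graph n)"
    "card (edges A \<inter> edges B) = k"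
  then have "(s - 1) choose 2 < card (verts A \<inter> verts B) choose 2"
    using card_common_edges_le[of A B] assms(2) by (metis in_copies_complete less_le_trans)
  then show "s \<le> card (verts A \<inter> verts B)"
    using binomial_2_less_imp_less by fastforce
qed

text \<open>Without triangles, three common edges force four common vertices instead of three, which
  saves one power of \<open>n\<close>.\<close>

lemma C_coeff_3_bigo_triangle_free:
  assumes H: "simple_graph H" and "\<not> has_triangle H"
  shows "(\<lambda>n. real (C_coeff H 3 n)) \<in> O(\<lambda>n. real n ^ (2 * card (verts H) - 4))"
proof (rule C_coeff_bigo[OF H])
  fix n A B
  assume c: "A \<in> copies H (complete_graph n)" "B \<in> copies H (complete_graph n)"
    and 3: "card (edges A \<inter> edges B) = 3"
  have "\<not> has_triangle A"
    using has_triangle_map_graph[OF H] assms(2) c(1) by (metis in_copies_complete isomorphicE)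
  then show "4 \<le> card (verts A \<inter> verts B)"
    using three_common_edges_triangle_free[OF _ _ _ 3] c by (metis in_copies_complete)
qed

section \<open>Sorting pairs of copies by the size of their overlap\<close>

lemma sum_over_pairs_of_copies:
  fixes \<phi> :: "nat \<Rightarrow> real"
  assumes H: "simple_graph H" and L: "card (edges H) \<le> L"
  defines "C \<equiv> \<lambda>n. copies H (complete_graph n)"
  shows "(\<Sum>A\<in>C n. \<Sum>B\<in>C n. \<phi> (card (edges A \<inter> edges B))) = (\<Sum>k\<le>L. real (C_coeff H k n) * \<phi> k)"
proof -
  let ?P = "C n \<times> C n"
  define w where "w = (\<lambda>(A, B). card (edges A \<inter> edges B :: nat set set))"
  have fin: "finite ?P"
    by (simp add: C_def finite_copies_complete)
  have "card (edges A \<inter> edges B) \<le> L" if "A \<in> C n" for A B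
  proof -
    have "simple_graph A" "card (edges A) \<le> L"
      using that isomorphic_sizes(2)[OF H, of A] L by (simp_all add: C_def in_copies_complete)
    then show ?thesis
      using card_mono[OF finite_edges[of A], of "edges A \<inter> edges B"] by simp
  qed
  then have sub: "w ` ?P \<subseteq> {..L}"
    by (auto simp: w_def)
  have "(\<Sum>A\<in>C n. \<Sum>B\<in>C n. \<phi> (card (edges A \<inter> edges B))) = (\<Sum>x\<in>?P. \<phi> (w x))"
    by (simp add: sum.cartesian_product w_def case_prod_unfold)
  also have "\<dots> = (\<Sum>k\<le>L. \<Sum>x\<in>{x \<in> ?P. w x = k}. \<phi> (w x))"
    by (rule sum.group[OF fin finite_atMost sub, symmetric])
  also have "\<dots> = (\<Sum>k\<le>L. real (C_coeff H k n) * \<phi> k)"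
  proof (rule sum.cong[OF refl])
    fix k
    have "{x \<in> ?P. w x = k} = {(A, B). A \<in> C n \<and> B \<in> C n \<and> card (edges A \<inter> edges B) = k}"
      by (auto simp: w_def)
    then have "card {x \<in> ?P. w x = k} = C_coeff H k n"
      by (simp add: C_coeff_def C_def)
    then show "(\<Sum>x\<in>{x \<in> ?P. w x = k}. \<phi> (w x)) = real (C_coeff H k n) * \<phi> k"
      by simp
  qed
  finally show ?thesis .
qed

subsection \<open>The uniform distribution\<close>

lemma labeled_graphs_with_edges_eq:
  "{g \<in> labeled_graphs n. card (edges g) = m} = Pair {..<n} ` {B. B \<subseteq> [{..<n}]\<^bsup>2\<^esup> \<and> card B = m}"
  by (auto simp: labeled_graphs_def simple_graph_def)

lemma card_labeled_graphs_with_edges: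
  "card {g \<in> labeled_graphs n. card (edges g) = m} = (n choose 2) choose m"
proof -
  have "card {B. B \<subseteq> [{..<n}]\<^bsup>2\<^esup> \<and> card B = m} = (n choose 2) choose m"
    by (subst n_subsets) (simp_all add: finite_imp_finite_nsets)
  then show ?thesis
    unfolding labeled_graphs_with_edges_eq by (subst card_image) (auto simp: inj_on_def)
qed

lemma finite_labeled_graphs_with_edges: "finite {g \<in> labeled_graphs n. card (edges g) = m}"
proof -
  have "{B. B \<subseteq> [{..<n}]\<^bsup>2\<^esup> \<and> card B = m} \<subseteq> Pow ([{..<n}]\<^bsup>2\<^esup>)"
    by auto
  then have "finite {B. B \<subseteq> [{..<n}]\<^bsup>2\<^esup> \<and> card B = m}"
    by (rule finite_subset) (simp add: finite_imp_finite_nsets)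
  then show ?thesis
    unfolding labeled_graphs_with_edges_eq by simp
qed

text \<open>Complementing gives \<open>N - card F choose N - m\<close>, which is correctly zero when \<open>m < card F\<close>,
  unlike \<open>N - card F choose m - card F\<close>.\<close>

lemma card_supersets_of_size:
  assumes X: "finite X" and F: "F \<subseteq> X" and m: "m \<le> card X"
  shows "card {B. B \<subseteq> X \<and> card B = m \<and> F \<subseteq> B} = (card X - card F) choose (card X - m)"
proof -
  have fin: "finite B" if "B \<subseteq> X" for B
    using X that by (rule rev_finite_subset)
  have card_compl: "card (X - D) = m" if "D \<subseteq> X - F" "card D = card X - m" for D
    using that m fin X by (subst card_Diff_subset) auto
  have "bij_betw (\<lambda>B. X - B) {B. B \<subseteq> X \<and> card B = m \<and> F \<subseteq> B}
      {D. D \<subseteq> X - F \<and> card D = card X - m}"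
    by (rule bij_betw_byWitness[where f' = "\<lambda>D. X - D"])
      (use F m fin X card_compl in \<open>auto simp: card_Diff_subset\<close>)
  then have "card {B. B \<subseteq> X \<and> card B = m \<and> F \<subseteq> B} = card {D. D \<subseteq> X - F \<and> card D = card X - m}"
    by (rule bij_betw_same_card)
  also have "\<dots> = (card X - card F) choose (card X - m)"
    using X F fin by (subst n_subsets) (auto simp: card_Diff_subset)
  finally show ?thesis .
qed

text \<open>Induction on \<open>f\<close>: raising \<open>f\<close> by one multiplies either side by
  \<open>(m - f) / (N - f)\<close>.\<close>

lemma edge_prob_eq_binomial:
  assumes "m \<le> N" "f \<le> N"
  shows "edge_prob m N f = real ((N - f) choose (N - m)) / real (N choose m)"
  using assms(2)
proof (induction f)
  case 0
  then show ?case
    using assms(1) by (simp add: edge_prob_def falling_factorial_def flip: binomial_symmetric)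
next
  case (Suc f)
  let ?M = "N - f" and ?j = "N - m"
  have "real ((?M - ?j) * (?M choose ?j)) = real (?M * ((?M - 1) choose ?j))"
    by (simp only: binomial_absorb_comp)
  \<comment> \<open>For \<open>f > m\<close> the difference \<open>?M - ?j\<close> truncates, but
    then the binomial coefficient is 0 and the real identity survives.\<close>
  moreover have "real (?M - ?j) * real (?M choose ?j) = (real m - real f) * real (?M choose ?j)"
  proof (cases "?j \<le> ?M")
    case True
    then show ?thesis
      using Suc.prems assms(1) by (simp add: of_nat_diff)
  qed (simp add: not_le binomial_eq_0)
  ultimately have "(real m - real f) * real (?M choose ?j) = (real N - real f) * real ((?M - 1) choose ?j)"
    using Suc.prems by (simp add: of_nat_diff)
  then have step: "real ((?M - 1) choose ?j) = real (?M choose ?j) * ((real m - real f) / (real N - real f))"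
    using Suc.prems by (simp add: field_simps)
  have "edge_prob m N (Suc f) = edge_prob m N f * ((real m - real f) / (real N - real f))"
    by (simp add: edge_prob_def falling_factorial_def)
  also have "\<dots> = real ((?M - 1) choose ?j) / real (N choose m)"
    unfolding step using Suc.prems by (simp add: Suc.IH)
  finally show ?case
    by simp
qed

lemma expectation_graph_dist:
  fixes f :: "nat graph \<Rightarrow> real"
  assumes "m \<le> n choose 2"
  shows "measure_pmf.expectation (graph_dist n m) f
       = (\<Sum>g\<in>{g \<in> labeled_graphs n. card (edges g) = m}. f g) / real ((n choose 2) choose m)"
proof -
  let ?S = "{g \<in> labeled_graphs n. card (edges g) = m}"
  \<comment> \<open>Nonemptiness is what makes \<open>pmf_of_set\<close> the uniform
    distribution.\<close>
  have "?S \<noteq> {}"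
    using card_labeled_graphs_with_edges[of n m] assms by (metis card.empty binomial_eq_0_iff not_le)
  then show ?thesis
    unfolding graph_dist_def
    using integral_pmf_of_set[OF _ finite_labeled_graphs_with_edges]
    by (simp add: card_labeled_graphs_with_edges)
qed

text \<open>Finite support makes every function integrable, as the variance formula
  requires.\<close>

lemma finite_set_pmf_graph_dist:
  assumes "m \<le> n choose 2"
  shows "finite (set_pmf (graph_dist n m))"
proof -
  let ?S = "{g \<in> labeled_graphs n. card (edges g) = m}"
  have "?S \<noteq> {}"
    using card_labeled_graphs_with_edges[of n m] assms by (metis card.empty binomial_eq_0_iff not_le)
  then show ?thesis
    unfolding graph_dist_def
    by (simp add: set_pmf_of_set[OF _ finite_labeled_graphs_with_edges] finite_labeled_graphs_with_edges)
qed

text \<open>This identifies \<open>edge_prob\<close> as the probability that a prescribed set of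
  edges is present. It depends only on the size of that set.\<close>

lemma edge_prob_eq_fraction:
  assumes "m \<le> n choose 2" "F \<subseteq> [{..<n}]\<^bsup>2\<^esup>"
  shows "(\<Sum>g\<in>{g \<in> labeled_graphs n. card (edges g) = m}. of_bool (F \<subseteq> edges g))
       / real ((n choose 2) choose m) = edge_prob m (n choose 2) (card F)"
proof -
  let ?S = "{g \<in> labeled_graphs n. card (edges g) = m}" and ?X = "[{..<n}]\<^bsup>2\<^esup>"
  have fX: "finite ?X" and cX: "card ?X = n choose 2"
    by (simp_all add: finite_imp_finite_nsets)
  have F: "card F \<le> n choose 2"
    using card_mono[OF fX assms(2)] by simp
  have "(\<Sum>g\<in>?S. of_bool (F \<subseteq> edges g)) = real (card (?S \<inter> {g. F \<subseteq> edges g}))"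
    using finite_labeled_graphs_with_edges[of n m] by (simp add: of_bool_def sum.If_cases)
  also have "?S \<inter> {g. F \<subseteq> edges g} = Pair {..<n} ` {B. B \<subseteq> ?X \<and> card B = m \<and> F \<subseteq> B}"
    by (auto simp: labeled_graphs_def simple_graph_def)
  also have "card \<dots> = card {B. B \<subseteq> ?X \<and> card B = m \<and> F \<subseteq> B}"
    by (rule card_image) (auto simp: inj_on_def)
  also have "\<dots> = ((n choose 2) - card F) choose ((n choose 2) - m)"
    using card_supersets_of_size[OF fX assms(2), of m] assms(1) by simp
  finally show ?thesis
    using edge_prob_eq_binomial[OF assms(1) F] by simp
qed

section \<open>First and second moments of the number of copies\<close>

lemma num_copies_eq_sum:
  assumes "g \<in> labeled_graphs n"
  shows "real (num_copies H g) = (\<Sum>A\<in>copies H (complete_graph n). of_bool (edges A \<subseteq> edges g))"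
proof -
  have "num_copies H g = card {A \<in> copies H (complete_graph n). edges A \<subseteq> edges g}"
    unfolding num_copies_def copies_labeled[OF assms] ..
  then show ?thesis
    using finite_copies_complete[of H n] by (simp add: of_bool_def sum.If_cases Int_def)
qed

lemma expectation_num_copies:
  assumes H: "simple_graph H" and m: "m \<le> n choose 2"
  shows "measure_pmf.expectation (graph_dist n m) (\<lambda>g. real (num_copies H g))
       = c_coeff H n * edge_prob m (n choose 2) (card (edges H))"
proof -
  let ?S = "{g \<in> labeled_graphs n. card (edges g) = m}" and ?C = "copies H (complete_graph n)"
  have "(\<Sum>g\<in>?S. real (num_copies H g)) = (\<Sum>g\<in>?S. \<Sum>A\<in>?C. of_bool (edges A \<subseteq> edges g))"
    by (intro sum.cong refl num_copies_eq_sum) simp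
  also have "\<dots> = (\<Sum>A\<in>?C. \<Sum>g\<in>?S. of_bool (edges A \<subseteq> edges g))"
    by (rule sum.swap)
  finally have "measure_pmf.expectation (graph_dist n m) (\<lambda>g. real (num_copies H g))
      = (\<Sum>A\<in>?C. (\<Sum>g\<in>?S. of_bool (edges A \<subseteq> edges g)) / real ((n choose 2) choose m))"
    by (simp add: expectation_graph_dist[OF m] sum_divide_distrib)
  also have "\<dots> = (\<Sum>A\<in>?C. edge_prob m (n choose 2) (card (edges H)))"
  proof (rule sum.cong[OF refl])
    fix A assume A: "A \<in> ?C"
    then have "card (edges A) = card (edges H)"
      using isomorphic_sizes(2)[OF H, of A] by (simp add: in_copies_complete)
    then show "(\<Sum>g\<in>?S. of_bool (edges A \<subseteq> edges g)) / real ((n choose 2) choose m)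
        = edge_prob m (n choose 2) (card (edges H))"
      using edge_prob_eq_fraction[OF m edges_copy_subset[OF A]] by simp
  qed
  finally show ?thesis
    using card_copies_complete[OF H, of n] by simp
qed

text \<open>The product of the indicators of \<open>A\<close> and \<open>B\<close> is the indicator
  of the union of their edges, whose size is twice the edge count minus the overlap.\<close>

lemma expectation_num_copies_squared:
  assumes H: "simple_graph H" and m: "m \<le> n choose 2"
  defines "C \<equiv> copies H (complete_graph n)"
  shows "measure_pmf.expectation (graph_dist n m) (\<lambda>g. (real (num_copies H g))\<^sup>2)
       = (\<Sum>A\<in>C. \<Sum>B\<in>C. edge_prob m (n choose 2) (2 * card (edges H) - card (edges A \<inter> edges B)))"
proof -
  let ?S = "{g \<in> labeled_graphs n. card (edges g) = m}"
  let ?I = "\<lambda>F g. of_bool (F \<subseteq> edges g) :: real"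
  have "(\<Sum>g\<in>?S. (real (num_copies H g))\<^sup>2) = (\<Sum>g\<in>?S. \<Sum>A\<in>C. \<Sum>B\<in>C. ?I (edges A \<union> edges B) g)"
  proof (rule sum.cong[OF refl])
    fix g assume "g \<in> ?S"
    then have "real (num_copies H g) = (\<Sum>A\<in>C. ?I (edges A) g)"
      unfolding C_def by (intro num_copies_eq_sum) simp
    then show "(real (num_copies H g))\<^sup>2 = (\<Sum>A\<in>C. \<Sum>B\<in>C. ?I (edges A \<union> edges B) g)"
      by (simp add: power2_eq_square sum_product of_bool_conj)
  qed
  also have "\<dots> = (\<Sum>A\<in>C. \<Sum>g\<in>?S. \<Sum>B\<in>C. ?I (edges A \<union> edges B) g)"
    by (rule sum.swap)
  also have "\<dots> = (\<Sum>A\<in>C. \<Sum>B\<in>C. \<Sum>g\<in>?S. ?I (edges A \<union> edges B) g)"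
    by (intro sum.cong refl sum.swap)
  finally have "measure_pmf.expectation (graph_dist n m) (\<lambda>g. (real (num_copies H g))\<^sup>2)
      = (\<Sum>A\<in>C. \<Sum>B\<in>C. (\<Sum>g\<in>?S. ?I (edges A \<union> edges B) g) / real ((n choose 2) choose m))"
    by (simp add: expectation_graph_dist[OF m] sum_divide_distrib)
  also have "\<dots> = (\<Sum>A\<in>C. \<Sum>B\<in>C. edge_prob m (n choose 2) (2 * card (edges H) - card (edges A \<inter> edges B)))"
  proof (intro sum.cong refl)
    fix A B assume AB: "A \<in> C" "B \<in> C"
    have g: "finite (edges A)" "finite (edges B)"
      "card (edges A) = card (edges H)" "card (edges B) = card (edges H)"
      using AB isomorphic_sizes(2)[OF H, of A] isomorphic_sizes(2)[OF H, of B]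
        finite_edges[of A] finite_edges[of B]
      by (simp_all add: in_copies_complete C_def)
    have "card (edges A \<union> edges B) = 2 * card (edges H) - card (edges A \<inter> edges B)"
      using card_Un_Int[OF g(1,2)] g by simp
    moreover have "edges A \<union> edges B \<subseteq> [{..<n}]\<^bsup>2\<^esup>"
      using AB edges_copy_subset[of A H n] edges_copy_subset[of B H n] by (simp add: C_def)
    ultimately show "(\<Sum>g\<in>?S. ?I (edges A \<union> edges B) g) / real ((n choose 2) choose m)
        = edge_prob m (n choose 2) (2 * card (edges H) - card (edges A \<inter> edges B))"
      using edge_prob_eq_fraction[OF m, of "edges A \<union> edges B"] by (simp only:)
  qed
  finally show ?thesis .
qed

text \<open>The squared mean is one \<open>(P l)\<^sup>2\<close> for each ordered pair of copies, so
  it can be subtracted inside the double sum before sorting by overlap.\<close>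

lemma variance_num_copies:
  assumes H: "simple_graph H" and m: "m \<le> n choose 2" and L: "card (edges H) \<le> L"
  defines "l \<equiv> card (edges H)" and "P \<equiv> edge_prob m (n choose 2)"
  shows "measure_pmf.variance (graph_dist n m) (\<lambda>g. real (num_copies H g))
       = (\<Sum>k\<le>L. real (C_coeff H k n) * (P (2 * l - k) - (P l)\<^sup>2))"
proof -
  let ?C = "copies H (complete_graph n)"
  have "measure_pmf.variance (graph_dist n m) (\<lambda>g. real (num_copies H g))
      = measure_pmf.expectation (graph_dist n m) (\<lambda>g. (real (num_copies H g))\<^sup>2)
        - (measure_pmf.expectation (graph_dist n m) (\<lambda>g. real (num_copies H g)))\<^sup>2"
    by (intro measure_pmf.variance_eq integrable_measure_pmf_finite finite_set_pmf_graph_dist m)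
  also have "\<dots> = (\<Sum>A\<in>?C. \<Sum>B\<in>?C. P (2 * l - card (edges A \<inter> edges B))) - (real (card ?C) * P l)\<^sup>2"
    unfolding expectation_num_copies_squared[OF H m] expectation_num_copies[OF H m]
      card_copies_complete[OF H] P_def l_def ..
  also have "\<dots> = (\<Sum>A\<in>?C. \<Sum>B\<in>?C. P (2 * l - card (edges A \<inter> edges B)) - (P l)\<^sup>2)"
    by (simp add: sum_subtractf power2_eq_square mult_ac)
  also have "\<dots> = (\<Sum>k\<le>L. real (C_coeff H k n) * (P (2 * l - k) - (P l)\<^sup>2))"
    by (rule sum_over_pairs_of_copies[OF H L])
  finally show ?thesis .
qed

lemma sum_C_coeff:
  assumes H: "simple_graph H" and L: "card (edges H) \<le> L"
  shows "(\<Sum>k\<le>L. real (C_coeff H k n)) = (c_coeff H n)\<^sup>2"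
  using sum_over_pairs_of_copies[OF H L, of "\<lambda>_. 1" n] card_copies_complete[OF H, of n]
  by (simp add: power2_eq_square)

text \<open>Edge-transitivity in terms of the \<open>C_coeff\<close>: the mean overlap of two copies
  is exactly the squared edge count over \<open>n choose 2\<close>.\<close>

lemma sum_C_coeff_weighted:
  assumes H: "simple_graph H" and L: "card (edges H) \<le> L"
  shows "real (n choose 2) * (\<Sum>k\<le>L. real (C_coeff H k n) * real k)
       = (real (card (edges H)) * c_coeff H n)\<^sup>2"
  using sum_over_pairs_of_copies[OF H L, of real n] sum_card_common_edges[OF H, of n] by simp

subsection \<open>Asymptotic expansions\<close>

lemma cmult_bigo:
  fixes f g :: "'a \<Rightarrow> real"
  assumes "f \<in> O[F](g)"
  shows "(\<lambda>x. c * f x) \<in> O[F](g)"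
  using landau_o.big.mult[OF bigo_const[of c F] assms] by simp

lemma diff_in_bigo_imp_bigo:
  fixes f g :: "'a \<Rightarrow> real"
  assumes "(\<lambda>x. f x - g x) \<in> O[F](h)" "g \<in> O[F](h)"
  shows "f \<in> O[F](h)"
  using sum_in_bigo(1)[OF assms] by simp

text \<open>Split \<open>f * g - a * b\<close> as \<open>(f - a) * g + a * (g - b)\<close>.\<close>

lemma mult_diff_in_bigo:
  fixes f g a b h k :: "'a \<Rightarrow> real"
  assumes "(\<lambda>x. f x - a x) \<in> O[F](h)" "(\<lambda>x. g x - b x) \<in> O[F](h)"
    and "a \<in> O[F](\<lambda>_. 1)" "g \<in> O[F](\<lambda>_. 1)"
  shows "(\<lambda>x. f x * g x - a x * b x) \<in> O[F](h)"
proof -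
  have "(\<lambda>x. (f x - a x) * g x) \<in> O[F](h)" "(\<lambda>x. a x * (g x - b x)) \<in> O[F](h)"
    using landau_o.big.mult[OF assms(1,4)] landau_o.big.mult[OF assms(3,2)] by simp_all
  from sum_in_bigo(1)[OF this] show ?thesis
    by (simp add: algebra_simps)
qed

lemma power_diff_in_bigo:
  fixes q p h :: "'a \<Rightarrow> real"
  assumes "(\<lambda>x. q x - p x) \<in> O[F](h)" "q \<in> O[F](\<lambda>_. 1)" "p \<in> O[F](\<lambda>_. 1)"
  shows "(\<lambda>x. q x ^ m - p x ^ m) \<in> O[F](h)"
proof (induction m)
  case (Suc m)
  have "(\<lambda>x. p x ^ m) \<in> O[F](\<lambda>_. 1)"
    using landau_o.big_power[OF assms(3), of m] by simp
  from mult_diff_in_bigo[OF Suc assms(1) this assms(2)] show ?case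
    by (simp add: mult.commute)
qed simp

section \<open>Expanding \<open>edge_prob\<close> in powers of \<open>1 / N\<close>\<close>

text \<open>The remainder is exactly \<open>- m\<^sup>2 * (1 - q) / (N * (N - m))\<close>. Once
  \<open>N > 2 * m\<close>, the factor \<open>N - m\<close> exceeds \<open>N / 2\<close>, whence the
  constant 2.\<close>

lemma shifted_ratio_expansion:
  fixes E N :: "nat \<Rightarrow> nat" and m :: nat
  assumes N: "filterlim N at_top sequentially" and le: "\<And>n. E n \<le> N n"
  defines "q \<equiv> \<lambda>n. real (E n) / real (N n)"
  shows "(\<lambda>n. (real (E n) - real m) / (real (N n) - real m)
            - (q n - real m * (1 - q n) / real (N n))) \<in> O(\<lambda>n. (1 / real (N n)) ^ 2)"
proof (rule bigoI[where c = "2 * real m ^ 2"])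
  have "eventually (\<lambda>n. 2 * m + 1 \<le> N n) sequentially"
    using N by (simp add: filterlim_at_top)
  then show "\<forall>\<^sub>F n in sequentially.
      norm ((real (E n) - real m) / (real (N n) - real m) - (q n - real m * (1 - q n) / real (N n)))
      \<le> 2 * real m ^ 2 * norm ((1 / real (N n)) ^ 2)"
  proof eventually_elim
    case (elim n)
    define x where "x = real (N n)"
    define M where "M = real m"
    have x: "x > 0" "2 * M < x" and M: "M \<ge> 0"
      using elim by (auto simp: x_def M_def)
    have q: "0 \<le> q n" "q n \<le> 1"
      using le[of n] by (auto simp: q_def divide_le_eq_1)
    have E: "real (E n) = q n * x"
      using x by (simp add: q_def x_def)
    have "(q n * x - M) / (x - M) - (q n - M * (1 - q n) / x) = - (M\<^sup>2 * (1 - q n)) / (x * (x - M))"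
      using x M by (simp add: field_simps power2_eq_square)
    also have "\<bar>\<dots>\<bar> = M\<^sup>2 * (1 - q n) / (x * (x - M))"
      using x M q by (simp add: abs_mult abs_divide)
    also have "\<dots> \<le> M\<^sup>2 * 1 / (x * (x / 2))"
      using x M q by (intro frac_le mult_left_mono) auto
    also have "\<dots> = 2 * M ^ 2 * \<bar>(1 / x) ^ 2\<bar>"
      using x by (simp add: power2_eq_square)
    finally show ?case
      unfolding E x_def[symmetric] M_def[symmetric] by simp
  qed
qed

text \<open>Multiply up the factors \<open>(E - i) / (N - i)\<close> for \<open>i < m\<close>; their
  first-order corrections add up, and \<open>0 + ... + (m - 1)\<close> is
  \<open>m choose 2\<close>.\<close>

lemma edge_prob_expansion:
  fixes E N :: "nat \<Rightarrow> nat" and m :: nat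
  assumes N: "filterlim N at_top sequentially" and le: "\<And>n. E n \<le> N n"
  defines "q \<equiv> \<lambda>n. real (E n) / real (N n)"
  shows "(\<lambda>n. edge_prob (E n) (N n) m
            - (q n ^ m - real (m choose 2) * q n ^ (m - 1) * (1 - q n) / real (N n)))
         \<in> O(\<lambda>n. (1 / real (N n)) ^ 2)"
proof (induction m)
  case 0
  then show ?case
    by (simp add: edge_prob_def falling_factorial_def binomial_eq_0)
next
  case (Suc m)
  define x where "x = (\<lambda>n. 1 / real (N n))"
  define a where "a = (\<lambda>n. q n ^ m - real (m choose 2) * q n ^ (m - 1) * (1 - q n) * x n)"
  define b where "b = (\<lambda>n. q n - real m * (1 - q n) * x n)"
  define R where "R = (\<lambda>n. (real (E n) - real m) / (real (N n) - real m))"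
  have q: "0 \<le> q n" "q n \<le> 1" for n
    using le[of n] by (auto simp: q_def divide_le_eq_1)
  have q1: "q \<in> O(\<lambda>_. 1)"
    by (rule bigoI[of _ 1]) (use q in auto)
  have x1: "x \<in> O(\<lambda>_. 1)"
  proof (rule bigoI[of _ 1], rule always_eventually, rule allI)
    show "norm (x n) \<le> 1 * norm (1::real)" for n
      \<comment> \<open>Division by zero yields 0, so the bound holds at every
        \<open>n\<close>.\<close>
      by (cases "N n = 0") (auto simp: x_def divide_le_eq_1)
  qed
  have qm: "(\<lambda>n. q n ^ k) \<in> O(\<lambda>_. 1)" for k
    using landau_o.big_power[OF q1, of k] by simp
  have q1': "(\<lambda>n. 1 - q n) \<in> O(\<lambda>_. 1)"
    using q1 by (intro sum_in_bigo) auto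
  have mult1: "(\<lambda>n. f n * g n) \<in> O(\<lambda>_. 1)" if "f \<in> O(\<lambda>_. 1)" "g \<in> O(\<lambda>_. 1)" for f g :: "nat \<Rightarrow> real"
    using landau_o.big.mult[OF that] by simp
  have a1: "a \<in> O(\<lambda>_. 1)" and b1: "b \<in> O(\<lambda>_. 1)"
    unfolding a_def b_def using q1 q1' qm x1 by (auto intro!: sum_in_bigo mult1)
  have sq1: "(\<lambda>n. (1 / real (N n)) ^ 2) \<in> O(\<lambda>_. 1)"
    using mult1[OF x1 x1] by (simp add: x_def power2_eq_square)
  have rb: "(\<lambda>n. R n - b n) \<in> O(\<lambda>n. (1 / real (N n)) ^ 2)"
    using shifted_ratio_expansion[OF N le, of m] by (simp add: R_def b_def q_def x_def)
  have R1: "R \<in> O(\<lambda>_. 1)"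
    using landau_o.big_trans[OF rb sq1] b1 by (rule diff_in_bigo_imp_bigo)
  have pa: "(\<lambda>n. edge_prob (E n) (N n) m - a n) \<in> O(\<lambda>n. (1 / real (N n)) ^ 2)"
    using Suc by (simp add: a_def x_def)
  have "(\<lambda>n. edge_prob (E n) (N n) m * R n - a n * b n) \<in> O(\<lambda>n. (1 / real (N n)) ^ 2)"
    by (rule mult_diff_in_bigo[OF pa rb a1 R1])
  moreover have "edge_prob (E n) (N n) (Suc m) = edge_prob (E n) (N n) m * R n" for n
    by (simp add: edge_prob_def falling_factorial_def R_def)
  ultimately have 1: "(\<lambda>n. edge_prob (E n) (N n) (Suc m) - a n * b n) \<in> O(\<lambda>n. (1 / real (N n)) ^ 2)"
    by simp
  have "(\<lambda>n. real (m choose 2) * real m * q n ^ (m - 1) * (1 - q n) * (1 - q n)) \<in> O(\<lambda>_. 1)"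
    using q1' qm by (auto intro!: mult1)
  from landau_o.big.mult[OF this landau_o.big_refl[of "\<lambda>n. x n ^ 2"]]
  have 2: "(\<lambda>n. real (m choose 2) * real m * q n ^ (m - 1) * (1 - q n) * (1 - q n) * x n ^ 2)
      \<in> O(\<lambda>n. (1 / real (N n)) ^ 2)"
    by (simp add: x_def power_divide)
  \<comment> \<open>Only the product of the two corrections is of second order. The case
    \<open>m = 0\<close> is separate because the exponent \<open>m - 1\<close> truncates there; its
    coefficient is 0.\<close>
  have eq: "a n * b n = (q n ^ Suc m - real (Suc m choose 2) * q n ^ m * (1 - q n) * x n)
      + real (m choose 2) * real m * q n ^ (m - 1) * (1 - q n) * (1 - q n) * x n ^ 2" for n
  proof (cases m)
    case (Suc j)
    have c: "real (Suc m choose 2) = real (m choose 2) + real m"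
      by (simp add: numeral_2_eq_2)
    show ?thesis
      unfolding c a_def b_def by (simp add: Suc algebra_simps power2_eq_square)
  qed (simp add: a_def b_def binomial_eq_0)
  have "edge_prob (E n) (N n) (Suc m) - a n * b n
      + real (m choose 2) * real m * q n ^ (m - 1) * (1 - q n) * (1 - q n) * x n ^ 2
      = edge_prob (E n) (N n) (Suc m)
        - (q n ^ Suc m - real (Suc m choose 2) * q n ^ (Suc m - 1) * (1 - q n) / real (N n))" for n
    unfolding eq by (simp add: x_def)
  with sum_in_bigo(1)[OF 1 2] show ?case
    by (simp only:)
qed

text \<open>To first order the difference is governed by \<open>2 * l choose 2\<close> minus twice
  \<open>l choose 2\<close>, which is the square of \<open>l\<close>. Second-order precision is
  required since this factor will multiply the squared number of copies.\<close>

lemma edge_prob_deviation: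
  fixes E N :: "nat \<Rightarrow> nat" and l :: nat
  assumes N: "filterlim N at_top sequentially" and le: "\<And>n. E n \<le> N n"
  defines "q \<equiv> \<lambda>n. real (E n) / real (N n)"
  shows "(\<lambda>n. edge_prob (E n) (N n) (2 * l) - edge_prob (E n) (N n) l ^ 2
            + (real l)\<^sup>2 * (q n ^ (2 * l - 1) * (1 - q n)) / real (N n))
         \<in> O(\<lambda>n. (1 / real (N n)) ^ 2)"
proof -
  define x where "x = (\<lambda>n. 1 / real (N n))"
  define a where "a = (\<lambda>m n. q n ^ m - real (m choose 2) * q n ^ (m - 1) * (1 - q n) * x n)"
  have ex: "(\<lambda>n. edge_prob (E n) (N n) m - a m n) \<in> O(\<lambda>n. (x n)\<^sup>2)" for m
    using edge_prob_expansion[OF N le, of m] by (simp add: a_def x_def q_def)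
  have q: "0 \<le> q n" "q n \<le> 1" for n
    using le[of n] by (auto simp: q_def divide_le_eq_1)
  have x: "0 \<le> x n" "x n \<le> 1" for n
    by (cases "N n = 0"; simp add: x_def divide_le_eq_1)+
  have q1: "q \<in> O(\<lambda>_. 1)" and x1: "x \<in> O(\<lambda>_. 1)"
    by (rule bigoI[of _ 1], use q x in auto)+
  have mult1: "(\<lambda>n. f n * g n) \<in> O(\<lambda>_. 1)" if "f \<in> O(\<lambda>_. 1)" "g \<in> O(\<lambda>_. 1)" for f g :: "nat \<Rightarrow> real"
    using landau_o.big.mult[OF that] by simp
  have qm: "(\<lambda>n. q n ^ k) \<in> O(\<lambda>_. 1)" for k
    using landau_o.big_power[OF q1, of k] by simp
  have q1': "(\<lambda>n. 1 - q n) \<in> O(\<lambda>_. 1)"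
    using q1 by (intro sum_in_bigo) auto
  have a1: "a l \<in> O(\<lambda>_. 1)"
    unfolding a_def using q1' qm x1 by (auto intro!: sum_in_bigo mult1)
  have "(\<lambda>n. (x n)\<^sup>2) \<in> O(\<lambda>_. 1)"
    using mult1[OF x1 x1] by (simp add: power2_eq_square)
  then have P1: "(\<lambda>n. edge_prob (E n) (N n) l) \<in> O(\<lambda>_. 1)"
    using diff_in_bigo_imp_bigo[OF landau_o.big_trans[OF ex] a1] by simp
  have 1: "(\<lambda>n. edge_prob (E n) (N n) l ^ 2 - a l n * a l n) \<in> O(\<lambda>n. (x n)\<^sup>2)"
    using mult_diff_in_bigo[OF ex ex a1 P1] by (simp add: power2_eq_square)
  have "(\<lambda>n. (real (l choose 2) * q n ^ (l - 1) * (1 - q n)) * (real (l choose 2) * q n ^ (l - 1) * (1 - q n)))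
      \<in> O(\<lambda>_. 1)"
    using q1' qm by (auto intro!: mult1)
  from landau_o.big.mult[OF this landau_o.big_refl[of "\<lambda>n. (x n)\<^sup>2"]]
  have 2: "(\<lambda>n. (real (l choose 2) * q n ^ (l - 1) * (1 - q n))\<^sup>2 * (x n)\<^sup>2) \<in> O(\<lambda>n. (x n)\<^sup>2)"
    by (simp add: power2_eq_square)
  have ch: "real (2 * l choose 2) = 2 * real (l choose 2) + (real l)\<^sup>2"
  proof -
    have "2 * l choose 2 = 2 * (l choose 2) + l\<^sup>2"
      by (induction l) (simp_all add: numeral_2_eq_2 power2_eq_square algebra_simps)
    then show ?thesis
      by (simp flip: of_nat_power of_nat_add of_nat_mult)
  qed
  have eq: "a (2 * l) n + (real l)\<^sup>2 * (q n ^ (2 * l - 1) * (1 - q n)) * x n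
      = a l n * a l n - (real (l choose 2) * q n ^ (l - 1) * (1 - q n))\<^sup>2 * (x n)\<^sup>2" for n
  proof (cases l)
    case (Suc j)
    have "2 * l - 1 = l + j" "2 * l = l + l" "l - 1 = j"
      using Suc by simp_all
    then show ?thesis
      unfolding a_def ch by (simp only: power_add) (simp add: Suc algebra_simps power2_eq_square)
  qed (simp add: a_def binomial_eq_0)
  from sum_in_bigo(2)[OF sum_in_bigo(2)[OF ex[of "2 * l"] 1] 2]
  have "(\<lambda>n. edge_prob (E n) (N n) (2 * l) - a (2 * l) n - (edge_prob (E n) (N n) l ^ 2 - a l n * a l n)
      - (real (l choose 2) * q n ^ (l - 1) * (1 - q n))\<^sup>2 * (x n)\<^sup>2) \<in> O(\<lambda>n. (x n)\<^sup>2)" .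
  moreover have "edge_prob (E n) (N n) (2 * l) - a (2 * l) n - (edge_prob (E n) (N n) l ^ 2 - a l n * a l n)
      - (real (l choose 2) * q n ^ (l - 1) * (1 - q n))\<^sup>2 * (x n)\<^sup>2
      = edge_prob (E n) (N n) (2 * l) - edge_prob (E n) (N n) l ^ 2
        + (real l)\<^sup>2 * (q n ^ (2 * l - 1) * (1 - q n)) / real (N n)" for n
    using eq[of n] by (simp add: x_def)
  ultimately show ?thesis
    by (simp only: x_def)
qed

text \<open>Dropping the first-order correction and replacing \<open>q\<close> by \<open>p\<close>
  each cost \<open>O(1 / N)\<close>. This precision suffices for the mean and for overlapping
  pairs.\<close>

lemma edge_prob_limit:
  fixes E N :: "nat \<Rightarrow> nat" and m :: nat and p :: real
  assumes N: "filterlim N at_top sequentially" and le: "\<And>n. E n \<le> N n"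
    and qp: "(\<lambda>n. real (E n) / real (N n) - p) \<in> O(\<lambda>n. 1 / real (N n))"
  shows "(\<lambda>n. edge_prob (E n) (N n) m - p ^ m) \<in> O(\<lambda>n. 1 / real (N n))"
proof -
  define q where "q = (\<lambda>n. real (E n) / real (N n))"
  define x where "x = (\<lambda>n. 1 / real (N n))"
  have q: "0 \<le> q n" "q n \<le> 1" for n
    using le[of n] by (auto simp: q_def divide_le_eq_1)
  have x: "0 \<le> x n" "x n \<le> 1" for n
    by (cases "N n = 0"; simp add: x_def divide_le_eq_1)+
  have q1: "q \<in> O(\<lambda>_. 1)" and x1: "x \<in> O(\<lambda>_. 1)"
    by (rule bigoI[of _ 1], use q x in auto)+
  have mult1: "(\<lambda>n. f n * g n) \<in> O(\<lambda>_. 1)" if "f \<in> O(\<lambda>_. 1)" "g \<in> O(\<lambda>_. 1)" for f g :: "nat \<Rightarrow> real"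
    using landau_o.big.mult[OF that] by simp
  have qm: "(\<lambda>n. q n ^ k) \<in> O(\<lambda>_. 1)" for k
    using landau_o.big_power[OF q1, of k] by simp
  have q1': "(\<lambda>n. 1 - q n) \<in> O(\<lambda>_. 1)"
    using q1 by (intro sum_in_bigo) auto
  have "(\<lambda>n. (x n)\<^sup>2) \<in> O(x)"
    using landau_o.big.mult[OF x1 landau_o.big_refl[of x]] by (simp add: power2_eq_square)
  from landau_o.big_trans[OF _ this]
  have 1: "(\<lambda>n. edge_prob (E n) (N n) m - (q n ^ m - real (m choose 2) * q n ^ (m - 1) * (1 - q n) * x n))
      \<in> O(x)"
    using edge_prob_expansion[OF N le, of m] by (simp add: x_def q_def)
  have "(\<lambda>n. real (m choose 2) * q n ^ (m - 1) * (1 - q n)) \<in> O(\<lambda>_. 1)"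
    using q1' qm by (auto intro!: mult1)
  from landau_o.big.mult[OF this landau_o.big_refl[of x]]
  have 2: "(\<lambda>n. real (m choose 2) * q n ^ (m - 1) * (1 - q n) * x n) \<in> O(x)"
    by simp
  have 3: "(\<lambda>n. q n ^ m - p ^ m) \<in> O(x)"
    using power_diff_in_bigo[of q "\<lambda>_. p" sequentially x m] qp q1 by (simp add: q_def x_def)
  show ?thesis
    using sum_in_bigo(1)[OF sum_in_bigo(2)[OF 1 2] 3] by (simp add: x_def)
qed

section \<open>Growth of falling factorials and of \<open>n choose 2\<close>\<close>

lemma falling_factorial_bigo:
  assumes "2 \<le> v"
  shows "(\<lambda>n. falling_factorial (real n) v
            - (real n ^ v - real v * (real v - 1) / 2 * real n ^ (v - 1))) \<in> O(\<lambda>n. real n ^ (v - 2))"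
  using assms
proof (induction v rule: nat_induct_at_least)
  case base
  have "falling_factorial (real n) 2 = real n ^ 2 - real 2 * (real 2 - 1) / 2 * real n ^ (2 - 1)" for n
    by (simp add: falling_factorial_def numeral_2_eq_2 algebra_simps)
  then show ?case
    by simp
next
  case (Suc v)
  define c where "c = real v * (real v - 1) / 2"
  have "v - 1 = Suc (v - 2)"
    using Suc.hyps by simp
  then have pow: "(\<lambda>n. real n ^ (v - 1)) = (\<lambda>n. real n ^ (v - 2) * real n)"
    by (simp add: mult.commute)
  have "(\<lambda>n. real n - real v) \<in> O(\<lambda>n. real n)"
    by real_asymp
  from landau_o.big.mult[OF Suc.IH this]
  have 1: "(\<lambda>n. (falling_factorial (real n) v - (real n ^ v - c * real n ^ (v - 1))) * (real n - real v))
      \<in> O(\<lambda>n. real n ^ (v - 1))"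
    unfolding pow c_def .
  have 2: "(\<lambda>n. c * real v * real n ^ (v - 1)) \<in> O(\<lambda>n. real n ^ (v - 1))"
    by simp
  \<comment> \<open>Multiplying by \<open>n - v\<close> adds \<open>v\<close> to the second
    coefficient; the stray term of degree \<open>v - 1\<close> goes into the error.\<close>
  have eq: "(falling_factorial (real n) v - (real n ^ v - c * real n ^ (v - 1))) * (real n - real v)
      + c * real v * real n ^ (v - 1)
      = falling_factorial (real n) (Suc v) - (real n ^ Suc v - (c + real v) * real n ^ v)" for n
  proof -
    have "real n ^ v = real n * real n ^ (v - 1)"
      using Suc.hyps by (cases v) auto
    then show ?thesis
      by (simp add: falling_factorial_def algebra_simps)
  qed
  have c: "c + real v = real (Suc v) * (real (Suc v) - 1) / 2"
    by (simp add: c_def field_simps)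
  show ?case
    using sum_in_bigo(1)[OF 1 2] unfolding eq c by simp
qed

lemma real_choose_two: "real (n choose 2) = real n * (real n - 1) / 2"
  by (induction n) (simp_all add: numeral_2_eq_2 field_simps)

lemma inverse_choose_two_bigo: "(\<lambda>n. 1 / real (n choose 2)) \<in> O(\<lambda>n. 1 / real n ^ 2)"
  unfolding real_choose_two by real_asymp

lemma filterlim_choose_two: "filterlim (\<lambda>n. n choose 2) at_top sequentially"
proof -
  have "filterlim (\<lambda>n. real (n choose 2)) at_top sequentially"
    unfolding real_choose_two by real_asymp
  then show ?thesis
    by (simp add: filterlim_sequentially_iff_filterlim_real)
qed

lemma mult_inverse_power_bigo:
  fixes f g :: "nat \<Rightarrow> real"
  assumes "f \<in> O(\<lambda>n. 1 / real n ^ j)" "g \<in> O(\<lambda>n. real n ^ k)" "j \<le> k"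
  shows "(\<lambda>n. g n * f n) \<in> O(\<lambda>n. real n ^ (k - j))"
proof -
  have "(\<lambda>n. g n * f n) \<in> O(\<lambda>n. real n ^ k * (1 / real n ^ j))"
    by (rule landau_o.big.mult[OF assms(2,1)])
  also have "(\<lambda>n. real n ^ k * (1 / real n ^ j)) \<in> O(\<lambda>n. real n ^ (k - j))"
    using assms(3)
    by (intro bigoI[of _ 1] eventually_sequentiallyI[of 1]) (simp add: power_diff)
  finally show ?thesis .
qed

subsection \<open>Expectation and variance\<close>

text \<open>Because the mean overlap is known exactly, \<open>k * a\<close> may be subtracted from
  each term and restored in total, for any \<open>a\<close>. The proper \<open>a\<close> will make
  the factor of \<open>(c_coeff H n)\<^sup>2\<close> second order.\<close>

lemma variance_num_copies_split:
  fixes a :: real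
  assumes H: "simple_graph H" and m: "m \<le> n choose 2" and L: "card (edges H) \<le> L"
    and n: "2 \<le> n"
  defines "l \<equiv> card (edges H)" and "P \<equiv> edge_prob m (n choose 2)"
  shows "measure_pmf.variance (graph_dist n m) (\<lambda>g. real (num_copies H g))
       = (c_coeff H n)\<^sup>2 * (P (2 * l) - (P l)\<^sup>2 + (real l)\<^sup>2 * a / real (n choose 2))
         + (\<Sum>k\<le>L. real (C_coeff H k n) * (P (2 * l - k) - P (2 * l) - real k * a))"
proof -
  have "real (n choose 2) > 0"
    using n by simp
  then have w: "(\<Sum>k\<le>L. real (C_coeff H k n) * real k)
      = (real l * c_coeff H n)\<^sup>2 / real (n choose 2)"
    using sum_C_coeff_weighted[OF H L, of n] by (simp add: field_simps l_def)
  have "(\<Sum>k\<le>L. real (C_coeff H k n) * (P (2 * l - k) - (P l)\<^sup>2))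
      = (\<Sum>k\<le>L. real (C_coeff H k n) * (P (2 * l - k) - P (2 * l) - real k * a)
          + real (C_coeff H k n) * (P (2 * l) - (P l)\<^sup>2) + real (C_coeff H k n) * real k * a)"
    by (simp add: algebra_simps)
  also have "\<dots> = (\<Sum>k\<le>L. real (C_coeff H k n) * (P (2 * l - k) - P (2 * l) - real k * a))
      + (c_coeff H n)\<^sup>2 * (P (2 * l) - (P l)\<^sup>2) + (real l * c_coeff H n)\<^sup>2 / real (n choose 2) * a"
    by (simp only: sum.distrib sum_C_coeff[OF H L] w flip: sum_distrib_right)
  also have "\<dots> = (c_coeff H n)\<^sup>2 * (P (2 * l) - (P l)\<^sup>2 + (real l)\<^sup>2 * a / real (n choose 2))
         + (\<Sum>k\<le>L. real (C_coeff H k n) * (P (2 * l - k) - P (2 * l) - real k * a))"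
    by (simp add: algebra_simps power_mult_distrib)
  finally show ?thesis
    unfolding variance_num_copies[OF H m L] l_def P_def .
qed

theorem theorem1p1:
  fixes H :: "'a graph" and v l :: nat and p :: real and E :: "nat \<Rightarrow> nat"
  assumes "simple_graph H"
    and "v = card (verts H)"
    and "l = card (edges H)"
    and "l > 1"
    and "\<forall>x\<in>verts H. \<exists>e\<in>edges H. x \<in> e"
    and "0 < p" and "p < 1"
    and "\<forall>n. E n \<le> n choose 2"
    and "(\<lambda>n. real (E n) - p * real (n choose 2)) \<in> O(\<lambda>_. 1)"
  defines "ET \<equiv> \<lambda>n. measure_pmf.expectation (graph_dist n (E n)) (\<lambda>g. real (num_copies H g))"
    and "VarT \<equiv> \<lambda>n. measure_pmf.variance (graph_dist n (E n)) (\<lambda>g. real (num_copies H g))"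
    and "C2_term \<equiv> \<lambda>n. real (C_coeff H 2 n) * p ^ (2 * l - 2) * (1 - p) ^ 2"
    and "C3_term \<equiv> \<lambda>n. real (C_coeff H 3 n) * p ^ (2 * l - 3) * (1 - 3 * p ^ 2 + 2 * p ^ 3)"
  shows "(\<forall>n\<ge>v. ET n = c_coeff H n * edge_prob (E n) (n choose 2) l)
    \<and> (\<lambda>n. ET n - c_coeff H n * p ^ l) \<in> O(\<lambda>n. real n ^ (v - 2))
    \<and> (\<lambda>n. ET n - 1 / real (card (automorphisms H)) *
            (real n ^ v * p ^ l - real v * (real v - 1) / 2 * real n ^ (v - 1) * p ^ l))
        \<in> O(\<lambda>n. real n ^ (v - 2))
    \<and> (\<lambda>n. VarT n - (C2_term n + C3_term n)) \<in> O(\<lambda>n. real n ^ (2 * v - 4))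
    \<and> VarT \<in> O(\<lambda>n. real n ^ (2 * v - 3))
    \<and> (\<not> has_triangle H \<longrightarrow>
         C3_term \<in> O(\<lambda>n. real n ^ (2 * v - 4))
         \<and> (\<lambda>n. VarT n - C2_term n) \<in> O(\<lambda>n. real n ^ (2 * v - 4)))"
proof -
  note H = assms(1) and l = assms(4) and p = assms(6,7) and EN = assms(8)[rule_format]
  define N where "N = (\<lambda>n::nat. n choose 2)"
  define P where "P = (\<lambda>m n. edge_prob (E n) (N n) m)"
  define q where "q = (\<lambda>n. real (E n) / real (N n))"
  define S where "S = real (card (automorphisms H))"
  have EN': "E n \<le> N n" for n
    using EN by (simp add: N_def)
  have N: "filterlim N at_top sequentially"
    unfolding N_def by (rule filterlim_choose_two)
  have N2: "(\<lambda>n. 1 / real (N n)) \<in> O(\<lambda>n. 1 / real n ^ 2)"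
    unfolding N_def by (rule inverse_choose_two_bigo)
  have N4: "(\<lambda>n. (1 / real (N n)) ^ 2) \<in> O(\<lambda>n. 1 / real n ^ 4)"
    using landau_o.big_power[OF N2, of 2] by (simp add: power_divide flip: power_mult)

  have fV: "finite (verts H)"
    using H by (simp add: simple_graph_def)
  \<comment> \<open>Two edges need three vertices. With \<open>v\<close> at least 3, none of the
    exponents \<open>v - 2\<close>, \<open>2 * v - 4\<close>, \<open>2 * v - 5\<close>
    truncates.\<close>
  have "l \<le> v choose 2"
    using card_mono[of "[verts H]\<^bsup>2\<^esup>" "edges H"] H assms(2,3)
    by (simp add: simple_graph_def finite_imp_finite_nsets)
  then have "2 choose 2 < v choose 2"
    using l by simp
  then have "2 < v"
    by (rule binomial_2_less_imp_less)
  then have v: "3 \<le> v"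
    by simp

  have qp: "(\<lambda>n. q n - p) \<in> O(\<lambda>n. 1 / real (N n))"
  proof -
    have "(\<lambda>n. (real (E n) - p * real (N n)) * (1 / real (N n))) \<in> O(\<lambda>n. 1 * (1 / real (N n)))"
      using assms(9) unfolding N_def by (intro landau_o.big.mult landau_o.big_refl)
    \<comment> \<open>The rewriting fails where \<open>N n = 0\<close>, since division by zero would
      turn \<open>p\<close> into 0.\<close>
    moreover have "eventually (\<lambda>n. N n \<ge> 1) sequentially"
      using N by (simp add: filterlim_at_top)
    then have "eventually (\<lambda>n. (real (E n) - p * real (N n)) * (1 / real (N n)) = q n - p) sequentially"
      by eventually_elim (simp add: q_def diff_divide_distrib)
    ultimately show ?thesis
      by (simp add: landau_o.big.in_cong)
  qed
  have Plim: "(\<lambda>n. P m n - p ^ m) \<in> O(\<lambda>n. 1 / real (N n))" for m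
    unfolding P_def using edge_prob_limit[OF N EN'] qp by (simp add: q_def)

  have c_exp: "(\<lambda>n. c_coeff H n - 1 / S * (real n ^ v - real v * (real v - 1) / 2 * real n ^ (v - 1)))
      \<in> O(\<lambda>n. real n ^ (v - 2))"
  proof -
    have "(\<lambda>n. 1 / S * (falling_factorial (real n) v
            - (real n ^ v - real v * (real v - 1) / 2 * real n ^ (v - 1)))) \<in> O(\<lambda>n. real n ^ (v - 2))"
      using falling_factorial_bigo[of v] v by (intro cmult_bigo) simp
    then show ?thesis
      by (simp add: c_coeff_def S_def assms(2) right_diff_distrib)
  qed
  have pow_le: "(\<lambda>n. real n ^ i) \<in> O(\<lambda>n. real n ^ j)" if "i \<le> j" for i j
    using that
    by (intro bigoI[of _ 1] eventually_sequentiallyI[of 1]) (auto intro: power_increasing)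
  have c_big: "(\<lambda>n. c_coeff H n) \<in> O(\<lambda>n. real n ^ v)"
  proof (rule diff_in_bigo_imp_bigo)
    show "(\<lambda>n. c_coeff H n - 1 / S * (real n ^ v - real v * (real v - 1) / 2 * real n ^ (v - 1)))
        \<in> O(\<lambda>n. real n ^ v)"
      by (rule landau_o.big_trans[OF c_exp pow_le]) simp
    have "(\<lambda>n. real v * (real v - 1) / 2 * real n ^ (v - 1)) \<in> O(\<lambda>n. real n ^ v)"
      by (intro cmult_bigo pow_le) simp
    then have "(\<lambda>n. real n ^ v - real v * (real v - 1) / 2 * real n ^ (v - 1)) \<in> O(\<lambda>n. real n ^ v)"
      by (intro sum_in_bigo) auto
    then show "(\<lambda>n. 1 / S * (real n ^ v - real v * (real v - 1) / 2 * real n ^ (v - 1))) \<in> O(\<lambda>n. real n ^ v)"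
      by (intro cmult_bigo)
  qed

  have ET: "ET n = c_coeff H n * P l n" for n
    unfolding ET_def P_def N_def assms(3) by (rule expectation_num_copies[OF H EN])
  have ET1: "(\<lambda>n. ET n - c_coeff H n * p ^ l) \<in> O(\<lambda>n. real n ^ (v - 2))"
    using mult_inverse_power_bigo[OF landau_o.big_trans[OF Plim N2] c_big, of l] v
    by (simp add: ET right_diff_distrib)
  have ET2: "(\<lambda>n. ET n - 1 / S * (real n ^ v * p ^ l - real v * (real v - 1) / 2 * real n ^ (v - 1) * p ^ l))
      \<in> O(\<lambda>n. real n ^ (v - 2))"
  proof -
    have "(\<lambda>n. p ^ l * (c_coeff H n - 1 / S * (real n ^ v - real v * (real v - 1) / 2 * real n ^ (v - 1))))
        \<in> O(\<lambda>n. real n ^ (v - 2))"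
      using c_exp by (intro cmult_bigo)
    from sum_in_bigo(1)[OF ET1 this] show ?thesis
      by (simp add: algebra_simps)
  qed

  \<comment> \<open>This \<open>a\<close> cancels the first-order part of
    \<open>P (2 * l) - (P l)\<^sup>2\<close>, leaving \<open>r\<close>. The adjusted factor of the
    \<open>k\<close>-th term is \<open>g k\<close>, and \<open>\<gamma> k\<close> is its
    limit.\<close>
  define a where "a = (\<lambda>n. q n ^ (2 * l - 1) * (1 - q n))"
  define \<gamma> where "\<gamma> = (\<lambda>k. p ^ (2 * l - k) - p ^ (2 * l) - real k * (p ^ (2 * l - 1) * (1 - p)))"
  define g where "g = (\<lambda>k n. P (2 * l - k) n - P (2 * l) n - real k * a n)"
  define r where "r = (\<lambda>n. P (2 * l) n - (P l n)\<^sup>2 + (real l)\<^sup>2 * a n / real (N n))"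
  define C where "C = (\<lambda>k n. real (C_coeff H k n))"

  have q01: "0 \<le> q n" "q n \<le> 1" for n
    using EN'[of n] by (auto simp: q_def divide_le_eq_1)
  have q1: "q \<in> O(\<lambda>_. 1)"
    by (rule bigoI[of _ 1]) (use q01 in auto)
  have r: "r \<in> O(\<lambda>n. 1 / real n ^ 4)"
    using landau_o.big_trans[OF edge_prob_deviation[OF N EN'] N4, of l]
    by (simp add: r_def P_def a_def q_def)
  have g: "(\<lambda>n. g k n - \<gamma> k) \<in> O(\<lambda>n. 1 / real n ^ 2)" for k
  proof -
    have "(\<lambda>n. a n - p ^ (2 * l - 1) * (1 - p)) \<in> O(\<lambda>n. 1 / real (N n))"
    proof -
      have 1: "(\<lambda>n. q n ^ (2 * l - 1) - p ^ (2 * l - 1)) \<in> O(\<lambda>n. 1 / real (N n))"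
        using qp q1 by (intro power_diff_in_bigo) auto
      have 2: "(\<lambda>n. (1 - q n) - (1 - p)) \<in> O(\<lambda>n. 1 / real (N n))"
        using landau_o.big.uminus_in_iff[of "\<lambda>n. q n - p"] qp by simp
      have 3: "(\<lambda>n. 1 - q n) \<in> O(\<lambda>_. 1)"
        using q1 by (intro sum_in_bigo) auto
      show ?thesis
        unfolding a_def by (rule mult_diff_in_bigo[OF 1 2 _ 3]) simp
    qed
    then have "(\<lambda>n. real k * (a n - p ^ (2 * l - 1) * (1 - p))) \<in> O(\<lambda>n. 1 / real (N n))"
      by (intro cmult_bigo)
    from sum_in_bigo(2)[OF sum_in_bigo(2)[OF Plim[of "2 * l - k"] Plim[of "2 * l"]] this]
    have "(\<lambda>n. g k n - \<gamma> k) \<in> O(\<lambda>n. 1 / real (N n))"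
      by (simp add: g_def \<gamma>_def algebra_simps)
    then show ?thesis
      using N2 by (rule landau_o.big_trans)
  qed
  \<comment> \<open>Every exponent then exceeds \<open>2 * j\<close> honestly, and after factoring
    out \<open>p ^ (2 * j)\<close> the values of \<open>\<gamma>\<close> are polynomial identities,
    such as \<open>p - p ^ 4 - 3 * p ^ 3 * (1 - p) = p * (1 - 3 * p ^ 2 + 2 * p ^
    3)\<close>.\<close>
  obtain j where j: "l = j + 2"
    using l that[of "l - 2"] by simp
  have \<gamma>: "\<gamma> 0 = 0" "\<gamma> 1 = 0" "\<gamma> 2 = p ^ (2 * l - 2) * (1 - p) ^ 2"
    "\<gamma> 3 = p ^ (2 * l - 3) * (1 - 3 * p ^ 2 + 2 * p ^ 3)"
  proof -
    have e: "2 * l = 2 * j + 4" "2 * l - 1 = 2 * j + 3" "2 * l - 2 = 2 * j + 2" "2 * l - 3 = 2 * j + 1"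
      using j by simp_all
    have pow: "p ^ (2 * l) = p ^ (2 * j) * p ^ 4" "p ^ (2 * l - 1) = p ^ (2 * j) * p ^ 3"
      "p ^ (2 * l - 2) = p ^ (2 * j) * p ^ 2" "p ^ (2 * l - 3) = p ^ (2 * j) * p"
      unfolding e(2-4) unfolding e(1) power_add by simp_all
    show "\<gamma> 0 = 0"
      by (simp add: \<gamma>_def)
    show "\<gamma> 1 = 0" "\<gamma> 2 = p ^ (2 * l - 2) * (1 - p) ^ 2"
      "\<gamma> 3 = p ^ (2 * l - 3) * (1 - 3 * p ^ 2 + 2 * p ^ 3)"
      unfolding \<gamma>_def pow
      by (simp_all add: algebra_simps power2_eq_square power3_eq_cube power4_eq_xxxx)
  qed

  \<comment> \<open>The values 2, 3, 4 of \<open>s\<close> give the thresholds 0, 1, 3 for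
    \<open>k\<close>.\<close>
  have Cb: "C k \<in> O(\<lambda>n. real n ^ (2 * v - s))" if "(s - 1) choose 2 < k" for k s
    unfolding C_def assms(2) using C_coeff_bigo_le[OF H that] .
  have C1: "C k \<in> O(\<lambda>n. real n ^ (2 * v - 2))" if "k \<ge> 1" for k
    using Cb[of 2 k] that by (simp add: binomial_eq_0)
  have C2: "C k \<in> O(\<lambda>n. real n ^ (2 * v - 3))" if "k \<ge> 2" for k
    using Cb[of 3 k] that by simp
  have C4: "C k \<in> O(\<lambda>n. real n ^ (2 * v - 4))" if "k \<ge> 4" for k
    using Cb[of 4 k] that by (simp add: choose_two)

  \<comment> \<open>\<open>t k\<close> is the coefficient kept in the formula, so that one estimate
    covers kept and discarded terms alike.\<close>
  define t where "t = (\<lambda>k. if k = 2 \<or> k = 3 then \<gamma> k else 0)"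
  have term_big: "(\<lambda>n. C k n * (g k n - t k)) \<in> O(\<lambda>n. real n ^ (2 * v - 4))" for k
  proof -
    \<comment> \<open>For \<open>k = 0\<close> the factor \<open>g 0\<close> is exactly 0. For
      \<open>k = 1\<close> the limit is 0, so \<open>n ^ (2 * v - 2)\<close> gains two powers. For 2
      and 3 the error is even \<open>n ^ (2 * v - 5)\<close>. From 4 on, the count alone is small
      enough.\<close>
    consider "k = 0" | "k = 1" | "k = 2 \<or> k = 3" | "k \<ge> 4"
      by linarith
    then show ?thesis
    proof cases
      case 1
      then show ?thesis
        by (simp add: g_def t_def)
    next
      case 2
      then show ?thesis
        using mult_inverse_power_bigo[OF g[of 1] C1[of 1]] v \<gamma>(2) by (simp add: t_def)
    next
      case 3
      then have "(\<lambda>n. C k n * (g k n - \<gamma> k)) \<in> O(\<lambda>n. real n ^ (2 * v - 3 - 2))"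
        using v by (intro mult_inverse_power_bigo[OF g C2]) auto
      then show ?thesis
        using landau_o.big_trans[OF _ pow_le[of "2 * v - 3 - 2" "2 * v - 4"]] 3 by (simp add: t_def)
    next
      case 4
      have "(\<lambda>n. g k n - \<gamma> k) \<in> O(\<lambda>_. 1)"
        by (rule landau_o.big_trans[OF g]) real_asymp
      then have "g k \<in> O(\<lambda>_. 1)"
        by (rule diff_in_bigo_imp_bigo) simp
      from landau_o.big.mult[OF C4[OF 4] this] show ?thesis
        using 4 by (simp add: t_def)
    qed
  qed
  have main_eq: "VarT n - (C2_term n + C3_term n)
      = (c_coeff H n)\<^sup>2 * r n + (\<Sum>k\<le>2 * l. C k n * (g k n - t k))" if "n \<ge> 2" for n
  proof -
    have "VarT n = (c_coeff H n)\<^sup>2 * r n + (\<Sum>k\<le>2 * l. C k n * g k n)"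
      unfolding VarT_def C_def g_def r_def P_def N_def assms(3)
      by (rule variance_num_copies_split[OF H EN _ that]) simp
    \<comment> \<open>Summing to \<open>2 * l\<close> rather than \<open>l\<close> keeps the index 3
      in range when \<open>l = 2\<close>.\<close>
    moreover have "(\<Sum>k\<le>2 * l. C k n * t k) = (\<Sum>k\<in>{2, 3}. C k n * t k)"
      using l by (intro sum.mono_neutral_right) (auto simp: t_def)
    then have "(\<Sum>k\<le>2 * l. C k n * t k) = C2_term n + C3_term n"
      by (simp add: t_def \<gamma>(3,4) C2_term_def C3_term_def C_def mult.assoc)
    ultimately show ?thesis
      by (simp add: right_diff_distrib sum_subtractf)
  qed
  have c2r: "(\<lambda>n. (c_coeff H n)\<^sup>2 * r n) \<in> O(\<lambda>n. real n ^ (2 * v - 4))"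
  proof (rule mult_inverse_power_bigo[OF r])
    show "(\<lambda>n. (c_coeff H n)\<^sup>2) \<in> O(\<lambda>n. real n ^ (2 * v))"
      using landau_o.big_power[OF c_big, of 2] by (simp add: mult.commute flip: power_mult)
  qed (use v in simp)
  have "(\<lambda>n. (c_coeff H n)\<^sup>2 * r n + (\<Sum>k\<le>2 * l. C k n * (g k n - t k))) \<in> O(\<lambda>n. real n ^ (2 * v - 4))"
    by (intro sum_in_bigo(1) c2r big_sum_in_bigo term_big)
  moreover have "eventually (\<lambda>n. VarT n - (C2_term n + C3_term n)
      = (c_coeff H n)\<^sup>2 * r n + (\<Sum>k\<le>2 * l. C k n * (g k n - t k))) sequentially"
    using main_eq by (rule eventually_sequentiallyI)
  ultimately have Var1: "(\<lambda>n. VarT n - (C2_term n + C3_term n)) \<in> O(\<lambda>n. real n ^ (2 * v - 4))"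
    by (simp add: landau_o.big.in_cong)

  have C2_term: "C2_term = (\<lambda>n. \<gamma> 2 * C 2 n)" and C3_term: "C3_term = (\<lambda>n. \<gamma> 3 * C 3 n)"
    by (rule ext, simp only: C2_term_def C3_term_def \<gamma>(3,4) C_def mult_ac)+
  have "C2_term \<in> O(\<lambda>n. real n ^ (2 * v - 3))" "C3_term \<in> O(\<lambda>n. real n ^ (2 * v - 3))"
    unfolding C2_term C3_term by (rule cmult_bigo[OF C2], simp)+
  then have C23: "(\<lambda>n. C2_term n + C3_term n) \<in> O(\<lambda>n. real n ^ (2 * v - 3))"
    by (rule sum_in_bigo)
  have Var2: "VarT \<in> O(\<lambda>n. real n ^ (2 * v - 3))"
    by (rule diff_in_bigo_imp_bigo[OF landau_o.big_trans[OF Var1 pow_le] C23]) simp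

  have Var3: "C3_term \<in> O(\<lambda>n. real n ^ (2 * v - 4))
      \<and> (\<lambda>n. VarT n - C2_term n) \<in> O(\<lambda>n. real n ^ (2 * v - 4))" if "\<not> has_triangle H"
  proof -
    have C3: "C3_term \<in> O(\<lambda>n. real n ^ (2 * v - 4))"
      unfolding C3_term C_def assms(2)
      by (rule cmult_bigo[OF C_coeff_3_bigo_triangle_free[OF H that]])
    with sum_in_bigo(1)[OF Var1 C3] show ?thesis
      by simp
  qed
  have "\<forall>n\<ge>v. ET n = c_coeff H n * edge_prob (E n) (n choose 2) l"
    by (simp add: ET P_def N_def)
  then show ?thesis
    by (intro conjI impI ET1 ET2[unfolded S_def] Var1 Var2 Var3[THEN conjunct1] Var3[THEN conjunct2])
qed

end
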